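(* In the setting below, let $F_1,\dots,F_n\in K_w[\mathcal G\oplus\mathcal H]$ be nonzero, with $x$-initial terms $a_ix_1^{b_{i1}}\cdots x_n^{b_{in}}$ ($a_i\in K_w[\mathcal G]$), and suppose $j(F_1,\dots,F_n)=\det(b_{ij})\ne0$. Then for every $\Phi(\mathbf x)=\sum_{\mathbf k}\phi_{\mathbf k}\mathbf x^{\mathbf k}\in K_w^{\mathbf f}[\mathcal G\oplus\mathcal H]$, the series $\Phi(F_1,\dots,F_n)$ exists in $K_w[\mathcal G\oplus\mathcal H]$ and $$\mathop{\mathrm{Res}}_{\mathbf x}\Phi(F_1,\dots,F_n)\,J(F_1,\dots,F_n)=j(F_1,\dots,F_n)\,\mathop{\mathrm{Res}}_{\mathbf F}\Phi(F_1,\dots,F_n),$$ equivalently $$\mathop{\mathrm{CT}}_{\mathbf x}\Phi(F_1,\dots,F_n)\,LJ(F_1,\dots,F_n)=j(F_1,\dots,F_n)\,\mathop{\mathrm{CT}}_{\mathbf F}\Phi(F_1,\dots,F_n),$$ where the left-hand sides are computed in $K_w[\mathcal G\oplus\mathcal H]$ and $\mathop{\mathrm{Res}}_{\mathbf F}\Phi(\mathbf F)=\phi_{(-1,\dots,-1)}$, $\mathop{\mathrm{CT}}_{\mathbf F}\Phi(\mathbf F)=\phi_{\mathbf 0}$ are the coefficients of $\Phi(\mathbf x)$ regarded as an element of $K_w^{\mathbf f}[\mathcal G\oplus\mathcal H]$.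
   Context: $K$ is a field; a TOA-group is an abelian group with a translation-invariant total order; for a TOA-group $\mathcal A$, $K_w[\mathcal A]$ is the field of formal series $\sum c_at^a$ with well-ordered support; initial term = term of least order. Setting: $\mathcal G,\mathcal H$ abelian groups, $\mathcal H\cong\mathbb Z^n$ with basis $e_1,\dots,e_n$, and $\mathcal G\oplus\mathcal H$ carries a total order making it a TOA-group. Write $x_i=t^{e_i}$; every $\eta\in K_w[\mathcal G\oplus\mathcal H]$ is $\sum_{\mathbf k\in\mathbb Z^n}b_{\mathbf k}\mathbf x^{\mathbf k}$ with $b_{\mathbf k}\in K_w[\mathcal G]$; the $x$-initial term is the nonzero $b_{\mathbf k}\mathbf x^{\mathbf k}$ of least order. Operators: $\partial/\partial x_i$ acts termwise on exponents of $x_i$; $\mathop{\mathrm{CT}}_{\mathbf x}\eta=b_{\mathbf 0}$; $\mathop{\mathrm{Res}}_{\mathbf x}\eta=b_{(-1,\dots,-1)}$. Jacobian $J(F_1,\dots,F_n)=\det(\partial F_i/\partial x_j)$; log Jacobian $LJ(F_1,\dots,F_n)=\frac{x_1\cdots x_n}{F_1\cdots F_n}J(F_1,\dots,F_n)$; Jacobian number $j(F_1,\dots,F_n)=\det(b_{ij})$ where $a_i\mathbf x^{\mathbf b_i}$ is the $x$-initial term of $F_i$. For an injective endomorphism $\rho$ of $\mathcal G\oplus\mathcal H$, $a\le^\rho b\iff\rho(a)\le\rho(b)$, and $K_w^\rho[\mathcal G\oplus\mathcal H]$ is the field of formal series with support well-ordered for $\le^\rho$. If the initial term of $F_i$ is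 $c_it^{g_i}\mathbf x^{\mathbf b_i}$ ($c_i\in K$), $\mathbf f$ is the endomorphism fixing $\mathcal G$ with $e_i\mapsto g_i+\sum_jb_{ij}e_j$, and $K_w^{\mathbf f}=K_w^{\rho}$ with $\rho=\mathbf f$. For $\Phi=\sum_{\mathbf k}\phi_{\mathbf k}\mathbf x^{\mathbf k}$, $\Phi(F_1,\dots,F_n)=\sum_{\mathbf k}\phi_{\mathbf k}F_1^{k_1}\cdots F_n^{k_n}$ (strictly convergent sum). *)

theory Defs
  imports "HOL-Analysis.Analysis" "HOL-Library.Product_Plus"
begin

definition toa :: "('a::ab_group_add \<Rightarrow> 'a \<Rightarrow> bool) \<Rightarrow> bool" where
  "toa le \<longleftrightarrow> (\<forall>a. le a a) \<and> (\<forall>a b. le a b \<and> le b a \<longrightarrow> a = b)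
     \<and> (\<forall>a b c. le a b \<and> le b c \<longrightarrow> le a c) \<and> (\<forall>a b. le a b \<or> le b a)
     \<and> (\<forall>a b c. le a b \<longrightarrow> le (a + c) (b + c))"

definition wo_on :: "('a \<Rightarrow> 'a \<Rightarrow> bool) \<Rightarrow> 'a set \<Rightarrow> bool" where
  "wo_on le S \<longleftrightarrow> (\<forall>T \<subseteq> S. T \<noteq> {} \<longrightarrow> (\<exists>m\<in>T. \<forall>x\<in>T. le m x))"

definition hsupp :: "('a \<Rightarrow> 'k::zero) \<Rightarrow> 'a set" where
  "hsupp f = {a. f a \<noteq> 0}"

text \<open>The Hahn field K_w[A]: formal series sum c_a t^a, represented by
their coefficient functions, with well-ordered support.\<close>
definition hahn :: "('a \<Rightarrow> 'a \<Rightarrow> bool) \<Rightarrow> ('a \<Rightarrow> 'k::zero) set" where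
  "hahn le = {f. wo_on le (hsupp f)}"

definition hone :: "'a::zero \<Rightarrow> 'k::{zero,one}" where
  "hone = (\<lambda>a. if a = 0 then 1 else 0)"

definition tpow :: "'a \<Rightarrow> 'a \<Rightarrow> 'k::{zero,one}" where
  "tpow a = (\<lambda>b. if b = a then 1 else 0)"

text \<open>Product of formal series (convolution; finite sums for well-ordered supports).\<close>
definition hmul :: "('a::plus \<Rightarrow> 'k::comm_ring_1) \<Rightarrow> ('a \<Rightarrow> 'k) \<Rightarrow> 'a \<Rightarrow> 'k" where
  "hmul f g = (\<lambda>c. \<Sum>(a, b) \<in> {(a, b). a + b = c \<and> f a \<noteq> 0 \<and> g b \<noteq> 0}. f a * g b)"

definition hinv :: "('a::ab_group_add \<Rightarrow> 'a \<Rightarrow> bool) \<Rightarrow> ('a \<Rightarrow> 'k::field) \<Rightarrow> 'a \<Rightarrow> 'k" where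
  "hinv le f = (THE g. g \<in> hahn le \<and> hmul f g = hone)"

definition hpow :: "('a::ab_group_add \<Rightarrow> 'a \<Rightarrow> bool) \<Rightarrow> ('a \<Rightarrow> 'k::field) \<Rightarrow> int \<Rightarrow> 'a \<Rightarrow> 'k" where
  "hpow le f k = (if 0 \<le> k then (hmul f ^^ nat k) hone else (hmul (hinv le f) ^^ nat (- k)) hone)"

text \<open>Product of finitely many series indexed by a finite type (taken along
an enumeration of the index type; independent of the enumeration on K_w[A]).\<close>
definition hprod :: "('n::finite \<Rightarrow> 'a::ab_group_add \<Rightarrow> 'k::field) \<Rightarrow> 'a \<Rightarrow> 'k" where
  "hprod u = foldr hmul (map u (SOME xs. distinct xs \<and> set xs = (UNIV :: 'n set))) hone"

definition hsummable :: "('a \<Rightarrow> 'a \<Rightarrow> bool) \<Rightarrow> ('i \<Rightarrow> 'a \<Rightarrow> 'k::zero) \<Rightarrow> 'i set \<Rightarrow> bool" where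
  "hsummable le s I \<longleftrightarrow> (\<forall>i\<in>I. s i \<in> hahn le) \<and> wo_on le (\<Union>i\<in>I. hsupp (s i))
      \<and> (\<forall>a. finite {i \<in> I. s i a \<noteq> 0})"

definition hsum :: "('i \<Rightarrow> 'a \<Rightarrow> 'k::comm_monoid_add) \<Rightarrow> 'i set \<Rightarrow> 'a \<Rightarrow> 'k" where
  "hsum s I = (\<lambda>a. \<Sum>i \<in> {i \<in> I. s i a \<noteq> 0}. s i a)"

text \<open>Elements of G \<oplus> H are pairs (g, h) with h :: int^'n; x_i = t^(0, e_i).\<close>

definition xvar :: "'n::finite \<Rightarrow> ('g::ab_group_add \<times> (int^'n)) \<Rightarrow> 'k::field" where
  "xvar i = tpow (0, axis i 1)"

text \<open>Partial derivative d/dx_i: x^k maps to k_i x^(k - e_i).\<close>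
definition hpderiv :: "'n::finite \<Rightarrow> ('g::ab_group_add \<times> (int^'n) \<Rightarrow> 'k::field) \<Rightarrow> 'g \<times> (int^'n) \<Rightarrow> 'k" where
  "hpderiv i f = (\<lambda>(g, h). of_int (h $ i + 1) * f (g, h + axis i 1))"

definition CTx :: "('g \<times> (int^'n::finite) \<Rightarrow> 'k) \<Rightarrow> 'g \<Rightarrow> 'k" where
  "CTx f = (\<lambda>g. f (g, 0))"

definition Resx :: "('g \<times> (int^'n::finite) \<Rightarrow> 'k) \<Rightarrow> 'g \<Rightarrow> 'k" where
  "Resx f = (\<lambda>g. f (g, - 1))"

text \<open>The coefficient b_k \<in> K_w[G] of x^k, embedded into K_w[G \<oplus> H].\<close>
definition xcoeff :: "('g::ab_group_add \<times> (int^'n::finite) \<Rightarrow> 'k::zero) \<Rightarrow> int^'n \<Rightarrow> 'g \<times> (int^'n) \<Rightarrow> 'k" where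
  "xcoeff f k = (\<lambda>(g, h). if h = 0 then f (g, k) else 0)"

definition xslice :: "('g \<times> (int^'n::finite) \<Rightarrow> 'k::zero) \<Rightarrow> int^'n \<Rightarrow> 'g \<times> (int^'n) \<Rightarrow> 'k" where
  "xslice f k = (\<lambda>(g, h). if h = k then f (g, h) else 0)"

definition init_exp :: "('a \<Rightarrow> 'a \<Rightarrow> bool) \<Rightarrow> ('a \<Rightarrow> 'k::zero) \<Rightarrow> 'a" where
  "init_exp le f = (THE a. a \<in> hsupp f \<and> (\<forall>b\<in>hsupp f. le a b))"

definition xinit :: "('g \<times> (int^'n) \<Rightarrow> 'g \<times> (int^'n) \<Rightarrow> bool) \<Rightarrow> ('g \<times> (int^'n::finite) \<Rightarrow> 'k::zero) \<Rightarrow> int^'n" where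
  "xinit le f = (THE k. xslice f k \<noteq> (\<lambda>_. 0) \<and>
      (\<forall>k'. xslice f k' \<noteq> (\<lambda>_. 0) \<longrightarrow> le (init_exp le (xslice f k)) (init_exp le (xslice f k'))))"

definition jacnum :: "('g \<times> (int^'n) \<Rightarrow> 'g \<times> (int^'n) \<Rightarrow> bool) \<Rightarrow> ('n::finite \<Rightarrow> 'g \<times> (int^'n) \<Rightarrow> 'k::zero) \<Rightarrow> int" where
  "jacnum le F = det (\<chi> i j. xinit le (F i) $ j)"

definition hdet :: "('n::finite \<Rightarrow> 'n \<Rightarrow> 'g::ab_group_add \<times> (int^'n) \<Rightarrow> 'k::field) \<Rightarrow> 'g \<times> (int^'n) \<Rightarrow> 'k" where
  "hdet M = (\<lambda>a. \<Sum>p \<in> {p. p permutes (UNIV :: 'n set)}. of_int (sign p) * hprod (\<lambda>i. M i (p i)) a)"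

definition jacobian :: "('n::finite \<Rightarrow> 'g::ab_group_add \<times> (int^'n) \<Rightarrow> 'k::field) \<Rightarrow> 'g \<times> (int^'n) \<Rightarrow> 'k" where
  "jacobian F = hdet (\<lambda>i j. hpderiv j (F i))"

definition logjacobian :: "('g \<times> (int^'n) \<Rightarrow> 'g \<times> (int^'n) \<Rightarrow> bool) \<Rightarrow> ('n::finite \<Rightarrow> 'g::ab_group_add \<times> (int^'n) \<Rightarrow> 'k::field) \<Rightarrow> 'g \<times> (int^'n) \<Rightarrow> 'k" where
  "logjacobian le F = hmul (hmul (hprod xvar) (hinv le (hprod F))) (jacobian F)"

definition zmul :: "int \<Rightarrow> 'g::ab_group_add \<Rightarrow> 'g" where
  "zmul k g = (if 0 \<le> k then (\<Sum>_ \<in> {0..<nat k}. g) else - (\<Sum>_ \<in> {0..<nat (- k)}. g))"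

text \<open>The endomorphism f: fixes G, e_i \<mapsto> g_i + sum_j b_ij e_j, where the initial term
of F_i is c_i t^(g_i) x^(b_i).\<close>
definition fendo :: "('g \<times> (int^'n) \<Rightarrow> 'g \<times> (int^'n) \<Rightarrow> bool) \<Rightarrow> ('n::finite \<Rightarrow> 'g::ab_group_add \<times> (int^'n) \<Rightarrow> 'k::zero)
     \<Rightarrow> 'g \<times> (int^'n) \<Rightarrow> 'g \<times> (int^'n)" where
  "fendo le F = (\<lambda>(g, h). (g + (\<Sum>i\<in>UNIV. zmul (h $ i) (fst (init_exp le (F i)))),
                           (\<Sum>i\<in>UNIV. h $ i *s snd (init_exp le (F i)))))"

definition fle :: "('g \<times> (int^'n) \<Rightarrow> 'g \<times> (int^'n) \<Rightarrow> bool) \<Rightarrow> ('n::finite \<Rightarrow> 'g::ab_group_add \<times> (int^'n) \<Rightarrow> 'k::zero)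
     \<Rightarrow> 'g \<times> (int^'n) \<Rightarrow> 'g \<times> (int^'n) \<Rightarrow> bool" where
  "fle le F a b = le (fendo le F a) (fendo le F b)"

definition Fpow :: "('g \<times> (int^'n) \<Rightarrow> 'g \<times> (int^'n) \<Rightarrow> bool) \<Rightarrow> ('n::finite \<Rightarrow> 'g::ab_group_add \<times> (int^'n) \<Rightarrow> 'k::field)
     \<Rightarrow> int^'n \<Rightarrow> 'g \<times> (int^'n) \<Rightarrow> 'k" where
  "Fpow le F k = hprod (\<lambda>i. hpow le (F i) (k $ i))"

definition subst_terms :: "('g \<times> (int^'n) \<Rightarrow> 'g \<times> (int^'n) \<Rightarrow> bool) \<Rightarrow> ('g::ab_group_add \<times> (int^'n::finite) \<Rightarrow> 'k::field)
     \<Rightarrow> ('n \<Rightarrow> 'g \<times> (int^'n) \<Rightarrow> 'k) \<Rightarrow> int^'n \<Rightarrow> 'g \<times> (int^'n) \<Rightarrow> 'k" where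
  "subst_terms le Phi F k = hmul (xcoeff Phi k) (Fpow le F k)"

definition subst :: "('g \<times> (int^'n) \<Rightarrow> 'g \<times> (int^'n) \<Rightarrow> bool) \<Rightarrow> ('g::ab_group_add \<times> (int^'n::finite) \<Rightarrow> 'k::field)
     \<Rightarrow> ('n \<Rightarrow> 'g \<times> (int^'n) \<Rightarrow> 'k) \<Rightarrow> 'g \<times> (int^'n) \<Rightarrow> 'k" where
  "subst le Phi F = hsum (subst_terms le Phi F) UNIV"

end

theory Submission
  imports Defs "HOL-Library.Poly_Mapping" "HOL-Library.Ramsey" "HOL-Library.Set_Algebras"
    "HOL-Library.Sublist"
begin

text \<open>
  Write \<open>F\<^sub>i = c\<^sub>i t\<^bsup>a\<^sub>i\<^esup> (1 + \<epsilon>\<^sub>i)\<close> with \<open>\<epsilon>\<^sub>i\<close> of positive support. By Neumann's lemma the monoid \<open>W\<close>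
  generated by the supports of the \<open>\<epsilon>\<^sub>i\<close> is well-ordered, and the support of \<open>F\<^sup>k\<close> lies in \<open>\<^bold>f(k) + W\<close>;
  this gives the summability of \<open>\<Phi>(F)\<close> and reduces the theorem to \<open>CT F\<^sup>k LJ(F)\<close>, where
  \<open>LJ(F) = det(dlog F\<^sub>i)\<close>. If \<open>k\<^sub>i \<noteq> 0\<close>, row operations turn \<open>k\<^sub>i F\<^sup>k LJ(F)\<close> into the determinant with
  \<open>i\<close>-th row \<open>d(F\<^sup>k)\<close>, which is a divergence since the other rows are closed forms. If \<open>k = 0\<close>, then
  \<open>dlog F\<^sub>i = b\<^sub>i + dlog u\<^sub>i\<close> with \<open>u\<^sub>i = 1 + \<epsilon>\<^sub>i\<close>, and a determinant with a row \<open>dlog u\<close> has constant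
  term zero: as \<open>m u\<^sup>m dlog u = d(u\<^sup>m)\<close>, only the term \<open>m = 0\<close> of the expansion of \<open>(u - 1)\<^sup>M\<close> can
  contribute, while \<open>(u - 1)\<^sup>M\<close> contributes nothing to a given coefficient for large \<open>M\<close>.

  Both arguments divide by integers. To cover positive characteristic they are carried out over the
  integral monoid ring of the multiplicative monoid of \<open>K\<close>, which is torsion-free and maps onto \<open>K\<close>
  in such a way that the \<open>c\<^sub>i\<close> lift to units.
\<close>

section \<open>Almost full relations\<close>

definition almost_full_on :: "('a \<Rightarrow> 'a \<Rightarrow> bool) \<Rightarrow> 'a set \<Rightarrow> bool" where
  "almost_full_on P A \<longleftrightarrow> (\<forall>f :: nat \<Rightarrow> 'a. (\<forall>n. f n \<in> A) \<longrightarrow> (\<exists>i j. i < j \<and> P (f i) (f j)))"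

lemma almost_full_onI:
  "(\<And>f :: nat \<Rightarrow> 'a. (\<And>n. f n \<in> A) \<Longrightarrow> \<exists>i j. i < j \<and> P (f i) (f j)) \<Longrightarrow> almost_full_on P A"
  unfolding almost_full_on_def by blast

lemma almost_full_onD:
  fixes f :: "nat \<Rightarrow> 'a"
  assumes "almost_full_on P A" "\<And>n. f n \<in> A"
  obtains i j where "i < j" "P (f i) (f j)"
  using assms unfolding almost_full_on_def by blast

lemma almost_full_on_subset: "almost_full_on P A \<Longrightarrow> B \<subseteq> A \<Longrightarrow> almost_full_on P B"
  unfolding almost_full_on_def by (meson subsetD)

lemma almost_full_on_homogeneous_subseq:
  fixes f :: "nat \<Rightarrow> 'a"
  assumes "almost_full_on P A" "\<And>n. f n \<in> A"
  obtains r :: "nat \<Rightarrow> nat" where "strict_mono r" "\<And>i j. i < j \<Longrightarrow> P (f (r i)) (f (r j))"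
proof -
  define colour where "colour X = (if P (f (Min X)) (f (Max X)) then 0 else 1 :: nat)" for X
  have colour: "colour {i, j} = (if P (f i) (f j) then 0 else 1)" if "i < j" for i j
    using that by (simp add: colour_def)
  have "\<forall>i\<in>UNIV. \<forall>j\<in>UNIV. i \<noteq> j \<longrightarrow> colour {i, j} < 2"
    by (simp add: colour_def)
  from Ramsey2[OF infinite_UNIV_nat this] obtain Y t
    where "infinite Y"
      and homogeneous: "\<And>i j. i \<in> Y \<Longrightarrow> j \<in> Y \<Longrightarrow> i \<noteq> j \<Longrightarrow> colour {i, j} = t"
    by metis
  define r where "r = enumerate Y"
  have "strict_mono r" and r_in_Y: "r n \<in> Y" for n
    using \<open>infinite Y\<close> by (simp_all add: r_def strict_mono_def enumerate_mono enumerate_in_set)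
  then have r_less: "r i < r j" if "i < j" for i j using that by (simp add: strict_mono_less)
  obtain i j where "i < j" "P (f (r i)) (f (r j))"
    by (rule almost_full_onD[OF assms(1)]) (rule assms(2))
  then have "t = 0"
    using homogeneous[OF r_in_Y r_in_Y, of i j] colour[OF r_less, of i j] r_less[of i j] by simp
  have "P (f (r i)) (f (r j))" if "i < j" for i j
  proof (rule ccontr)
    assume "\<not> P (f (r i)) (f (r j))"
    then show False
      using homogeneous[OF r_in_Y r_in_Y, of i j] colour[OF r_less, of i j] r_less[of i j]
        that \<open>t = 0\<close> by simp
  qed
  with \<open>strict_mono r\<close> show ?thesis by (rule that)
qed

lemma almost_full_on_Times:
  assumes "almost_full_on P A" "almost_full_on Q B"
  shows "almost_full_on (rel_prod P Q) (A \<times> B)"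
proof (rule almost_full_onI)
  fix f :: "nat \<Rightarrow> 'a \<times> 'b"
  assume "\<And>n. f n \<in> A \<times> B"
  then have fst: "fst (f n) \<in> A" and snd: "snd (f n) \<in> B" for n
    by (simp_all add: mem_Times_iff)
  obtain r :: "nat \<Rightarrow> nat"
    where homogeneous: "strict_mono r" "\<And>i j. i < j \<Longrightarrow> P (fst (f (r i))) (fst (f (r j)))"
    by (rule almost_full_on_homogeneous_subseq[OF assms(1), of "\<lambda>n. fst (f n)", OF fst]) (rule that)
  obtain i j where "i < j" "Q (snd (f (r i))) (snd (f (r j)))"
    by (rule almost_full_onD[OF assms(2), of "\<lambda>n. snd (f (r n))", OF snd])
  then have "r i < r j" and "rel_prod P Q (f (r i)) (f (r j))"
    using homogeneous by (simp_all add: rel_prod_sel strict_mono_less)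
  then show "\<exists>i j. i < j \<and> rel_prod P Q (f i) (f j)" by blast
qed

lemma almost_full_on_image:
  assumes "almost_full_on P A" "\<And>x y. x \<in> A \<Longrightarrow> y \<in> A \<Longrightarrow> P x y \<Longrightarrow> Q (h x) (h y)"
  shows "almost_full_on Q (h ` A)"
proof (rule almost_full_onI)
  fix f :: "nat \<Rightarrow> 'b"
  assume "\<And>n. f n \<in> h ` A"
  then have "\<forall>n. \<exists>x\<in>A. f n = h x" by blast
  then obtain g where preimages: "\<And>n. g n \<in> A" "\<And>n. f n = h (g n)" by metis
  obtain i j where "i < j" "P (g i) (g j)"
    by (rule almost_full_onD[OF assms(1), of g, OF preimages(1)])
  then have "i < j \<and> Q (f i) (f j)" using preimages assms(2) by simp
  then show "\<exists>i j. i < j \<and> Q (f i) (f j)" by blast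
qed

lemma almost_full_on_Un:
  assumes "almost_full_on P A" "almost_full_on P B"
  shows "almost_full_on P (A \<union> B)"
proof (rule almost_full_onI)
  fix f :: "nat \<Rightarrow> 'a"
  assume "\<And>n. f n \<in> A \<union> B"
  then have "f -` A \<union> f -` B = UNIV" by blast
  then have "infinite (f -` A) \<or> infinite (f -` B)"
    by (metis finite_Un infinite_UNIV_nat)
  then obtain C where infinitely_often: "infinite (f -` C)" "almost_full_on P C"
    using assms by blast
  then have "f (enumerate (f -` C) n) \<in> C" for n
    using enumerate_in_set by blast
  then obtain i j where "i < j" "P (f (enumerate (f -` C) i)) (f (enumerate (f -` C) j))"
    by (rule almost_full_onD[OF infinitely_often(2), of "\<lambda>n. f (enumerate (f -` C) n)"])
  then show "\<exists>i j. i < j \<and> P (f i) (f j)" using infinitely_often(1) enumerate_mono by blast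
qed

lemma almost_full_on_empty [simp]: "almost_full_on P {}"
  by (rule almost_full_onI) simp

lemma almost_full_on_finite_UN:
  assumes "finite I" "\<And>i. i \<in> I \<Longrightarrow> almost_full_on P (A i)"
  shows "almost_full_on P (\<Union>i\<in>I. A i)"
  using assms by (induction I rule: finite_induct) (auto intro: almost_full_on_Un)

lemma finite_if_almost_full_on:
  assumes "almost_full_on P A" "\<And>x y. x \<in> A \<Longrightarrow> y \<in> A \<Longrightarrow> P x y \<Longrightarrow> x = y"
  shows "finite A"
proof (rule ccontr)
  assume "infinite A"
  then obtain f :: "nat \<Rightarrow> 'a" where distinct_elements: "inj f" "\<And>n. f n \<in> A"
    using infinite_countable_subset[of A] by blast
  obtain i j where "i < j" "P (f i) (f j)"
    by (rule almost_full_onD[OF assms(1), of f, OF distinct_elements(2)])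
  then show False using distinct_elements assms(2) by (metis injD less_irrefl)
qed

subsection \<open>Higman's lemma\<close>

definition bad_seq :: "('a \<Rightarrow> 'a \<Rightarrow> bool) \<Rightarrow> 'a set \<Rightarrow> (nat \<Rightarrow> 'a) \<Rightarrow> bool" where
  "bad_seq P A f \<longleftrightarrow> (\<forall>n. f n \<in> A) \<and> (\<forall>i j. i < j \<longrightarrow> \<not> P (f i) (f j))"

lemma almost_full_on_iff_no_bad_seq: "almost_full_on P A \<longleftrightarrow> (\<nexists>f. bad_seq P A f)"
  unfolding almost_full_on_def bad_seq_def by metis

lemma bad_seqI_initial:
  assumes "\<And>n. \<exists>g. bad_seq P A g \<and> (\<forall>m\<le>n. g m = f m)"
  shows "bad_seq P A f"
  unfolding bad_seq_def
proof (intro conjI allI impI)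
  fix n
  obtain g where "bad_seq P A g" "g n = f n" using assms[of n] by blast
  then show "f n \<in> A" unfolding bad_seq_def by metis
next
  fix i j :: nat
  assume "i < j"
  moreover obtain g where "bad_seq P A g" "\<forall>m\<le>j. g m = f m" using assms[of j] by blast
  ultimately show "\<not> P (f i) (f j)" unfolding bad_seq_def by (metis less_imp_le order_refl)
qed

definition minimal_bad_at ::
    "('a \<Rightarrow> 'a \<Rightarrow> bool) \<Rightarrow> 'a set \<Rightarrow> ('a \<Rightarrow> nat) \<Rightarrow> nat \<Rightarrow> (nat \<Rightarrow> 'a) \<Rightarrow> bool" where
  "minimal_bad_at P A weight n f \<longleftrightarrow> bad_seq P A f \<and>
    (\<forall>g. bad_seq P A g \<longrightarrow> (\<forall>m<n. g m = f m) \<longrightarrow> weight (f n) \<le> weight (g n))"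

lemma ex_minimal_bad_at:
  assumes "bad_seq P A f"
  shows "\<exists>g. minimal_bad_at P A weight n g \<and> (\<forall>m<n. g m = f m)"
proof -
  define candidate where "candidate g \<longleftrightarrow> bad_seq P A g \<and> (\<forall>m<n. g m = f m)" for g
  have "candidate f" using assms by (simp add: candidate_def)
  then obtain g where "candidate g" "\<forall>h. candidate h \<longrightarrow> weight (g n) \<le> weight (h n)"
    using ex_has_least_nat[of candidate f "\<lambda>g. weight (g n)"] by blast
  then show ?thesis
    unfolding candidate_def minimal_bad_at_def by (intro exI[of _ g]) simp
qed

lemma minimal_bad_seq:
  assumes "bad_seq P A f"
  obtains g where "\<And>n. minimal_bad_at P A weight n g"
proof -
  have "\<exists>s. \<forall>n. minimal_bad_at P A weight n (s n) \<and> (\<forall>m<Suc n. s (Suc n) m = s n m)"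
  proof (rule dependent_nat_choice)
    show "\<exists>g. minimal_bad_at P A weight 0 g" using ex_minimal_bad_at[OF assms] by blast
    show "\<exists>h. minimal_bad_at P A weight (Suc n) h \<and> (\<forall>m<Suc n. h m = g m)"
      if "minimal_bad_at P A weight n g" for g n
      using ex_minimal_bad_at[of P A g weight "Suc n"] that by (simp add: minimal_bad_at_def)
  qed
  then obtain s where
    "\<forall>n. minimal_bad_at P A weight n (s n) \<and> (\<forall>m<Suc n. s (Suc n) m = s n m)" ..
  then have approximations: "minimal_bad_at P A weight n (s n)"
    and approximations_agree: "m < Suc n \<Longrightarrow> s (Suc n) m = s n m" for n m
    by simp_all
  have stable: "s m m = s n m" if "m \<le> n" for m n
    using that by (induction n rule: dec_induct) (simp_all add: approximations_agree)
  have bad: "bad_seq P A (\<lambda>n. s n n)"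
  proof (rule bad_seqI_initial)
    fix n
    have "\<forall>m\<le>n. s n m = s m m" using stable by metis
    then show "\<exists>g. bad_seq P A g \<and> (\<forall>m\<le>n. g m = s m m)"
      using approximations[of n] unfolding minimal_bad_at_def by blast
  qed
  show ?thesis
  proof (rule that)
    fix n
    have "\<forall>m<n. s m m = s n m" using stable by (metis less_imp_le)
    then show "minimal_bad_at P A weight n (\<lambda>n. s n n)"
      using bad approximations[of n] by (simp add: minimal_bad_at_def)
  qed
qed

lemma bad_seq_list_emb_tails:
  assumes bad: "bad_seq (list_emb P) (lists A) w" and w_Cons: "\<And>n. w n = x n # u n"
    and homogeneous: "strict_mono r" "\<And>i j. i < j \<Longrightarrow> P (x (r i)) (x (r j))"
  shows "bad_seq (list_emb P) (lists A) (\<lambda>n. if n < r 0 then w n else u (r (n - r 0)))"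
    (is "bad_seq _ _ ?v")
  unfolding bad_seq_def
proof (intro conjI allI impI)
  have words: "w n \<in> lists A" and not_emb: "i < j \<Longrightarrow> \<not> list_emb P (w i) (w j)" for n i j
    using bad by (simp_all add: bad_seq_def)
  have "u n \<in> lists A" for n using words[of n] by (simp add: w_Cons)
  with words show "?v n \<in> lists A" for n by simp
  fix i j :: nat
  assume "i < j"
  consider "j < r 0" | "i < r 0" "r 0 \<le> j" | "r 0 \<le> i" by linarith
  then show "\<not> list_emb P (?v i) (?v j)"
  proof cases
    case 1
    then show ?thesis using \<open>i < j\<close> not_emb by simp
  next
    case 2
    define k where "k = r (j - r 0)"
    have "r 0 \<le> k" using homogeneous(1) by (simp add: k_def strict_mono_less_eq)
    then have "\<not> list_emb P (w i) (x k # u k)" using 2 not_emb[of i k] by (simp add: w_Cons)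
    then have "\<not> list_emb P (w i) (u k)" by blast
    then show ?thesis using 2 by (simp add: k_def)
  next
    case 3
    define p q where "p = r (i - r 0)" and "q = r (j - r 0)"
    have "i - r 0 < j - r 0" using \<open>i < j\<close> 3 by simp
    then have "P (x p) (x q)" "p < q"
      using homogeneous by (simp_all add: p_def q_def strict_mono_less)
    then have "\<not> list_emb P (u p) (u q)" using not_emb[of p q] by (auto simp: w_Cons)
    then show ?thesis using 3 \<open>i < j\<close> by (simp add: p_def q_def)
  qed
qed

theorem higman:
  assumes "almost_full_on P A"
  shows "almost_full_on (list_emb P) (lists A)"
  unfolding almost_full_on_iff_no_bad_seq
proof (rule notI, elim exE)
  fix w0 assume "bad_seq (list_emb P) (lists A) w0"
  then obtain w where minimal: "\<And>n. minimal_bad_at (list_emb P) (lists A) length n w"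
    by (rule minimal_bad_seq) (rule that)
  then have bad: "bad_seq (list_emb P) (lists A) w" by (simp add: minimal_bad_at_def)
  define x u where "x n = hd (w n)" and "u n = tl (w n)" for n
  have w_Cons: "w n = x n # u n" for n
  proof -
    have "w n \<noteq> []" using bad list_emb_Nil[of P "w (Suc n)"] unfolding bad_seq_def by (metis lessI)
    then show ?thesis by (simp add: x_def u_def)
  qed
  have "w n \<in> lists A" for n using bad by (simp add: bad_seq_def)
  then have "x n \<in> A" for n by (metis w_Cons Cons_in_lists_iff)
  then obtain r :: "nat \<Rightarrow> nat"
    where homogeneous: "strict_mono r" "\<And>i j. i < j \<Longrightarrow> P (x (r i)) (x (r j))"
    by (rule almost_full_on_homogeneous_subseq[OF assms, of x]) (rule that)
  have "length (w (r 0)) \<le> length (u (r 0))"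
    using minimal[of "r 0"] bad_seq_list_emb_tails[OF bad w_Cons homogeneous]
    unfolding minimal_bad_at_def by fastforce
  then show False by (simp add: w_Cons)
qed

section \<open>Partially ordered groups\<close>

locale po_group =
  fixes le :: "'a::ab_group_add \<Rightarrow> 'a \<Rightarrow> bool" (infix "\<preceq>" 50)
  assumes le_refl [simp]: "a \<preceq> a"
    and le_antisym: "a \<preceq> b \<Longrightarrow> b \<preceq> a \<Longrightarrow> a = b"
    and le_trans: "a \<preceq> b \<Longrightarrow> b \<preceq> c \<Longrightarrow> a \<preceq> c"
    and le_add_right: "a \<preceq> b \<Longrightarrow> a + c \<preceq> b + c"
begin

lemma le_add_cancel_right [simp]: "a + c \<preceq> b + c \<longleftrightarrow> a \<preceq> b"
  using le_add_right[of a b c] le_add_right[of "a + c" "b + c" "- c"] by auto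

lemma le_add_mono: "a \<preceq> b \<Longrightarrow> c \<preceq> d \<Longrightarrow> a + c \<preceq> b + d"
  by (metis le_trans le_add_right add.commute)

lemma le_add_mono_eqD:
  assumes "a \<preceq> b" "c \<preceq> d" "a + c = b + d"
  shows "a = b" "c = d"
proof -
  have "a + c \<preceq> a + d" using le_add_mono[of a a c d] assms(2) by simp
  then have "b + d \<preceq> a + d" using assms(3) by simp
  then show "a = b" using assms(1) le_antisym by simp
  then show "c = d" using assms(3) by simp
qed

lemma almost_full_on_singleton [simp]: "almost_full_on (\<preceq>) {a}"
proof (rule almost_full_onI)
  fix f :: "nat \<Rightarrow> 'a"
  assume "\<And>n. f n \<in> {a}"
  then have "0 < (1 :: nat) \<and> f 0 \<preceq> f 1" by simp
  then show "\<exists>i j. i < j \<and> f i \<preceq> f j" by blast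
qed

lemma almost_full_on_set_plus:
  assumes "almost_full_on (\<preceq>) S" "almost_full_on (\<preceq>) T"
  shows "almost_full_on (\<preceq>) (S + T)"
  unfolding set_plus_image
  by (rule almost_full_on_image[OF almost_full_on_Times[OF assms]]) (auto intro: le_add_mono)

lemma finite_decompositions:
  assumes "almost_full_on (\<preceq>) S" "almost_full_on (\<preceq>) T"
  shows "finite {a \<in> S. c - a \<in> T}"
proof -
  let ?pairs = "{p \<in> S \<times> T. fst p + snd p = c}"
  have "finite ?pairs"
  proof (rule finite_if_almost_full_on)
    show "almost_full_on (rel_prod (\<preceq>) (\<preceq>)) ?pairs"
      by (rule almost_full_on_subset[OF almost_full_on_Times[OF assms]]) auto
    show "p = q" if "p \<in> ?pairs" "q \<in> ?pairs" "rel_prod (\<preceq>) (\<preceq>) p q" for p q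
      using that le_add_mono_eqD[of "fst p" "fst q" "snd p" "snd q"]
      by (simp add: rel_prod_sel prod_eq_iff)
  qed
  then have "finite (fst ` ?pairs)" by (rule finite_imageI)
  moreover have "{a \<in> S. c - a \<in> T} \<subseteq> fst ` ?pairs" by force
  ultimately show ?thesis by (rule finite_subset[rotated])
qed

end

subsection \<open>Neumann's lemma\<close>

definition word_sums :: "'a::monoid_add set \<Rightarrow> 'a set" where
  "word_sums E = sum_list ` lists E"

lemma zero_in_word_sums [simp]: "0 \<in> word_sums E"
  unfolding word_sums_def by (rule image_eqI[of _ _ "[]"]) auto

lemma word_sums_add:
  assumes "a \<in> word_sums E" "b \<in> word_sums E"
  shows "a + b \<in> word_sums E"
proof -
  obtain v w where "a = sum_list v" "v \<in> lists E" "b = sum_list w" "w \<in> lists E"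
    using assms unfolding word_sums_def by blast
  then have "a + b = sum_list (v @ w)" "v @ w \<in> lists E" by simp_all
  then show ?thesis unfolding word_sums_def by blast
qed

lemma subset_word_sums: "E \<subseteq> word_sums E"
  unfolding word_sums_def by (auto intro!: image_eqI[of _ _ "[_]"])

lemma word_sums_mono: "E \<subseteq> E' \<Longrightarrow> word_sums E \<subseteq> word_sums E'"
  unfolding word_sums_def by (intro image_mono lists_mono)

context po_group
begin

lemma sum_list_nonneg: "(\<And>e. e \<in> set w \<Longrightarrow> 0 \<preceq> e) \<Longrightarrow> 0 \<preceq> sum_list w"
  by (induction w) (auto intro: le_add_mono[of 0 _ 0, simplified])

lemma list_emb_sum_list:
  assumes "list_emb (\<preceq>) v w" "\<And>e. e \<in> set w \<Longrightarrow> 0 \<preceq> e \<and> e \<noteq> 0"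
  shows "sum_list v \<preceq> sum_list w" and "sum_list v = sum_list w \<Longrightarrow> v = w"
proof -
  have "sum_list v \<preceq> sum_list w \<and> (sum_list v = sum_list w \<longrightarrow> v = w)"
    using assms
  proof (induction rule: list_emb.induct)
    case (list_emb_Nil w)
    show ?case
    proof (cases w)
      case (Cons e w')
      have "0 \<preceq> e" "e \<noteq> 0" "0 \<preceq> sum_list w'"
        using list_emb_Nil Cons by (auto intro!: sum_list_nonneg)
      then show ?thesis
        using Cons le_add_mono[of 0 e 0 "sum_list w'"]
          le_add_mono_eqD[of 0 e 0 "sum_list w'"] by auto
    qed simp
  next
    case (list_emb_Cons v w e)
    then have "0 \<preceq> e" "e \<noteq> 0" "sum_list v \<preceq> sum_list w" by auto
    then show ?case
      using le_add_mono[of 0 e "sum_list v" "sum_list w"]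
        le_add_mono_eqD[of 0 e "sum_list v" "sum_list w"] by auto
  next
    case (list_emb_Cons2 d e v w)
    then have "sum_list v \<preceq> sum_list w" by auto
    then show ?case
      using list_emb_Cons2 le_add_mono[of d e "sum_list v" "sum_list w"]
        le_add_mono_eqD[of d e "sum_list v" "sum_list w"] by auto
  qed
  then show "sum_list v \<preceq> sum_list w" and "sum_list v = sum_list w \<Longrightarrow> v = w" by auto
qed

theorem neumann:
  assumes "almost_full_on (\<preceq>) E" "\<And>e. e \<in> E \<Longrightarrow> 0 \<preceq> e \<and> e \<noteq> 0"
  shows almost_full_on_word_sums: "almost_full_on (\<preceq>) (word_sums E)"
    and finite_words_with_sum: "finite {w \<in> lists E. sum_list w = a}"
proof -
  have emb: "sum_list v \<preceq> sum_list w" "sum_list v = sum_list w \<Longrightarrow> v = w"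
    if "list_emb (\<preceq>) v w" "w \<in> lists E" for v w
    using list_emb_sum_list[OF that(1)] that(2) assms(2) by auto
  show "almost_full_on (\<preceq>) (word_sums E)"
    unfolding word_sums_def by (rule almost_full_on_image[OF higman[OF assms(1)]]) (rule emb(1))
  have "almost_full_on (list_emb (\<preceq>)) {w \<in> lists E. sum_list w = a}"
    by (rule almost_full_on_subset[OF higman[OF assms(1)]]) auto
  then show "finite {w \<in> lists E. sum_list w = a}"
    by (rule finite_if_almost_full_on) (use emb(2) in auto)
qed

end

section \<open>Convolution of formal series\<close>

lemma hmul_eq_sum:
  fixes f g :: "'a::ab_group_add \<Rightarrow> 'k::comm_ring_1"
  assumes "finite A" "{a. f a \<noteq> 0 \<and> g (c - a) \<noteq> 0} \<subseteq> A"
  shows "hmul f g c = (\<Sum>a\<in>A. f a * g (c - a))"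
proof -
  have "hmul f g c = (\<Sum>a\<in>{a. f a \<noteq> 0 \<and> g (c - a) \<noteq> 0}. f a * g (c - a))"
    unfolding hmul_def
    by (rule sum.reindex_bij_witness[where i = "\<lambda>a. (a, c - a)" and j = fst])
      (auto simp: algebra_simps)
  also have "\<dots> = (\<Sum>a\<in>A. f a * g (c - a))"
    by (rule sum.mono_neutral_left) (use assms in auto)
  finally show ?thesis .
qed

lemma hsupp_hmul:
  fixes f g :: "'a::ab_group_add \<Rightarrow> 'k::comm_ring_1"
  shows "hsupp (hmul f g) \<subseteq> hsupp f + hsupp g"
proof
  fix c assume "c \<in> hsupp (hmul f g)"
  then have "(\<Sum>(a, b)\<in>{(a, b). a + b = c \<and> f a \<noteq> 0 \<and> g b \<noteq> 0}. f a * g b) \<noteq> 0"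
    by (simp add: hsupp_def hmul_def)
  then have "{(a, b). a + b = c \<and> f a \<noteq> 0 \<and> g b \<noteq> 0} \<noteq> {}"
    by (metis sum.empty)
  then obtain a b where "c = a + b" "a \<in> hsupp f" "b \<in> hsupp g" by (auto simp: hsupp_def)
  then show "c \<in> hsupp f + hsupp g" by (simp add: set_plus_intro)
qed

lemma hmul_commute: "hmul f g = hmul g (f :: 'a::ab_group_add \<Rightarrow> 'k::comm_ring_1)"
proof
  fix c
  show "hmul f g c = hmul g f c"
    unfolding hmul_def
    by (rule sum.reindex_bij_witness[where i = prod.swap and j = prod.swap])
      (auto simp: add.commute mult.commute)
qed

lemma hmul_hone_left [simp]: "hmul hone f = (f :: 'a::ab_group_add \<Rightarrow> 'k::comm_ring_1)"
proof
  fix c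
  show "hmul hone f c = f c"
    by (subst hmul_eq_sum[of "{0}"]) (auto simp: hone_def)
qed

lemma hsupp_hone_subset: "hsupp (hone :: 'a::zero \<Rightarrow> 'k::{zero,one}) \<subseteq> {0}"
  by (auto simp: hsupp_def hone_def)

lemma hsupp_add: "hsupp (\<lambda>a. f a + g a :: 'k::monoid_add) \<subseteq> hsupp f \<union> hsupp g"
  by (auto simp: hsupp_def)

lemma hsupp_mult: "hsupp (\<lambda>a. g a * f a :: 'k::mult_zero) \<subseteq> hsupp f"
  by (auto simp: hsupp_def)

lemma hsupp_hsum: "hsupp (hsum s I) \<subseteq> (\<Union>i\<in>I. hsupp (s i))"
proof
  fix a assume "a \<in> hsupp (hsum s I)"
  then have "{i \<in> I. s i a \<noteq> 0} \<noteq> {}"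
    unfolding hsupp_def hsum_def by (metis (mono_tags) mem_Collect_eq sum.empty)
  then show "a \<in> (\<Union>i\<in>I. hsupp (s i))" by (auto simp: hsupp_def)
qed

lemma hsum_eq_sum:
  assumes "finite J" "J \<subseteq> I" "{i \<in> I. s i a \<noteq> 0} \<subseteq> J"
  shows "hsum s I a = (\<Sum>i\<in>J. s i a)"
  unfolding hsum_def by (rule sum.mono_neutral_left) (use assms in auto)

context po_group
begin

lemma hmul_eq_sum_supports:
  fixes f g :: "'a \<Rightarrow> 'k::comm_ring_1"
  assumes "almost_full_on (\<preceq>) S" "almost_full_on (\<preceq>) T" "hsupp f \<subseteq> S" "hsupp g \<subseteq> T"
  shows "hmul f g c = (\<Sum>a\<in>{a \<in> S. c - a \<in> T}. f a * g (c - a))"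
  by (rule hmul_eq_sum)
    (use finite_decompositions[OF assms(1,2)] assms(3,4) in \<open>auto simp: hsupp_def\<close>)

lemma almost_full_on_hsupp_hmul:
  fixes f g :: "'a \<Rightarrow> 'k::comm_ring_1"
  assumes "almost_full_on (\<preceq>) (hsupp f)" "almost_full_on (\<preceq>) (hsupp g)"
  shows "almost_full_on (\<preceq>) (hsupp (hmul f g))"
  by (rule almost_full_on_subset[OF almost_full_on_set_plus[OF assms] hsupp_hmul])

lemma almost_full_on_hsupp_hone [simp]:
  "almost_full_on (\<preceq>) (hsupp (hone :: 'a \<Rightarrow> 'k::{zero,one}))"
  by (rule almost_full_on_subset[OF almost_full_on_singleton hsupp_hone_subset])

lemma hmul_assoc:
  fixes f g h :: "'a \<Rightarrow> 'k::comm_ring_1"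
  assumes supp_f: "almost_full_on (\<preceq>) (hsupp f)" and supp_g: "almost_full_on (\<preceq>) (hsupp g)"
    and supp_h: "almost_full_on (\<preceq>) (hsupp h)"
  shows "hmul (hmul f g) h = hmul f (hmul g h)"
proof
  fix c
  let ?S = "hsupp f" and ?T = "hsupp g" and ?U = "hsupp h"
  let ?B = "{b \<in> ?S + ?T. c - b \<in> ?U}" and ?A = "{a \<in> ?S. c - a \<in> ?T + ?U}"
  note supp_fg = almost_full_on_set_plus[OF supp_f supp_g]
    and supp_gh = almost_full_on_set_plus[OF supp_g supp_h]
  note finite_sums =
    finite_decompositions[OF supp_fg supp_h] finite_decompositions[OF supp_f supp_gh]
    finite_decompositions[OF supp_f supp_g] finite_decompositions[OF supp_g supp_h]
  have "hmul (hmul f g) h c = (\<Sum>b\<in>?B. hmul f g b * h (c - b))"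
    by (rule hmul_eq_sum_supports[OF supp_fg supp_h hsupp_hmul subset_refl])
  also have "\<dots> = (\<Sum>b\<in>?B. \<Sum>a\<in>{a \<in> ?S. b - a \<in> ?T}. f a * g (b - a) * h (c - b))"
    by (simp add: hmul_eq_sum_supports[OF supp_f supp_g subset_refl subset_refl] sum_distrib_right)
  also have "\<dots> = (\<Sum>(b, a)\<in>Sigma ?B (\<lambda>b. {a \<in> ?S. b - a \<in> ?T}). f a * g (b - a) * h (c - b))"
    by (rule sum.Sigma) (use finite_sums in auto)
  also have "\<dots> = (\<Sum>(a, b)\<in>Sigma ?A (\<lambda>a. {b \<in> ?T. c - a - b \<in> ?U}). f a * (g b * h (c - a - b)))"
  proof (rule sum.reindex_bij_witness
      [where i = "\<lambda>(a, b). (a + b, a)" and j = "\<lambda>(b, a). (a, b - a)"])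
    have "c - a \<in> ?T + ?U" if "b - a \<in> ?T" "c - b \<in> ?U" for a b
      using set_plus_intro[OF that] by simp
    then show "(case p of (b, a) \<Rightarrow> (a, b - a)) \<in> Sigma ?A (\<lambda>a. {b \<in> ?T. c - a - b \<in> ?U})"
      if "p \<in> Sigma ?B (\<lambda>b. {a \<in> ?S. b - a \<in> ?T})" for p
      using that by auto
    show "(case p of (a, b) \<Rightarrow> (a + b, a)) \<in> Sigma ?B (\<lambda>b. {a \<in> ?S. b - a \<in> ?T})"
      if "p \<in> Sigma ?A (\<lambda>a. {b \<in> ?T. c - a - b \<in> ?U})" for p
      using that by (auto simp: diff_diff_eq set_plus_intro)
  qed (auto simp: mult.assoc)
  also have "\<dots> = (\<Sum>a\<in>?A. \<Sum>b\<in>{b \<in> ?T. c - a - b \<in> ?U}. f a * (g b * h (c - a - b)))"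
    by (rule sum.Sigma[symmetric]) (use finite_sums in auto)
  also have "\<dots> = (\<Sum>a\<in>?A. f a * hmul g h (c - a))"
    by (simp add: hmul_eq_sum_supports[OF supp_g supp_h subset_refl subset_refl] sum_distrib_left)
  also have "\<dots> = hmul f (hmul g h) c"
    by (rule hmul_eq_sum_supports[OF supp_f supp_gh subset_refl hsupp_hmul, symmetric])
  finally show "hmul (hmul f g) h c = hmul f (hmul g h) c" .
qed

lemma hmul_add_left:
  fixes f g h :: "'a \<Rightarrow> 'k::comm_ring_1"
  assumes "almost_full_on (\<preceq>) (hsupp f)" "almost_full_on (\<preceq>) (hsupp g)"
    and supp_h: "almost_full_on (\<preceq>) (hsupp h)"
  shows "hmul (\<lambda>a. f a + g a) h = (\<lambda>a. hmul f h a + hmul g h a)"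
proof
  fix c
  note supp_fg = almost_full_on_Un[OF assms(1,2)]
  show "hmul (\<lambda>a. f a + g a) h c = hmul f h c + hmul g h c"
    unfolding hmul_eq_sum_supports[OF supp_fg supp_h hsupp_add subset_refl]
      hmul_eq_sum_supports[OF supp_fg supp_h Un_upper1 subset_refl]
      hmul_eq_sum_supports[OF supp_fg supp_h Un_upper2 subset_refl]
    by (simp add: distrib_right sum.distrib)
qed

lemma hmul_hsum:
  fixes s :: "'i \<Rightarrow> 'a \<Rightarrow> 'k::comm_ring_1"
  assumes summable: "almost_full_on (\<preceq>) (\<Union>i\<in>I. hsupp (s i))" "\<And>a. finite {i \<in> I. s i a \<noteq> 0}"
    and supp_g: "almost_full_on (\<preceq>) (hsupp g)"
  shows "hmul (hsum s I) g = hsum (\<lambda>i. hmul (s i) g) I"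
proof
  fix c
  let ?U = "\<Union>i\<in>I. hsupp (s i)"
  define A where "A = {a \<in> ?U. c - a \<in> hsupp g}"
  define J where "J = (\<Union>a\<in>A. {i \<in> I. s i a \<noteq> 0})"
  have "finite A" unfolding A_def by (rule finite_decompositions[OF summable(1) supp_g])
  then have "finite J" unfolding J_def using summable(2) by blast
  have hmul_s: "hmul (s i) g c = (\<Sum>a\<in>A. s i a * g (c - a))" if "i \<in> I" for i
    unfolding A_def
    by (rule hmul_eq_sum_supports[OF summable(1) supp_g _ subset_refl]) (use that in auto)
  have "hmul (hsum s I) g c = (\<Sum>a\<in>A. hsum s I a * g (c - a))"
    unfolding A_def by (rule hmul_eq_sum_supports[OF summable(1) supp_g hsupp_hsum subset_refl])
  also have "\<dots> = (\<Sum>a\<in>A. (\<Sum>i\<in>J. s i a) * g (c - a))"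
    by (intro sum.cong refl arg_cong2[of _ _ _ _ "(*)"] hsum_eq_sum \<open>finite J\<close>) (auto simp: J_def)
  also have "\<dots> = (\<Sum>i\<in>J. \<Sum>a\<in>A. s i a * g (c - a))"
    unfolding sum_distrib_right by (rule sum.swap)
  also have "\<dots> = (\<Sum>i\<in>J. hmul (s i) g c)"
    by (rule sum.cong) (auto simp: J_def hmul_s)
  also have "\<dots> = hsum (\<lambda>i. hmul (s i) g) I c"
  proof (rule hsum_eq_sum[symmetric, OF \<open>finite J\<close>])
    have "\<exists>a\<in>A. s i a \<noteq> 0" if "i \<in> I" "hmul (s i) g c \<noteq> 0" for i
    proof (rule ccontr)
      assume "\<not> ?thesis"
      then show False using that(2) by (simp add: hmul_s[OF that(1)])
    qed
    then show "{i \<in> I. hmul (s i) g c \<noteq> 0} \<subseteq> J" by (auto simp: J_def)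
  qed (auto simp: J_def)
  finally show "hmul (hsum s I) g c = hsum (\<lambda>i. hmul (s i) g) I c" .
qed

lemma eventually_hmul_eq:
  fixes f :: "'i \<Rightarrow> 'a \<Rightarrow> 'k::comm_ring_1"
  assumes supports: "almost_full_on (\<preceq>) S" "\<And>n. hsupp (f n) \<subseteq> S" "hsupp l \<subseteq> S"
    and supp_g: "almost_full_on (\<preceq>) (hsupp g)"
    and lim: "\<And>a. \<forall>\<^sub>F n in F. f n a = l a"
  shows "\<forall>\<^sub>F n in F. hmul (f n) g c = hmul l g c"
proof -
  let ?A = "{a \<in> S. c - a \<in> hsupp g}"
  have "\<forall>\<^sub>F n in F. \<forall>a\<in>?A. f n a = l a"
    by (rule eventually_ball_finite[OF finite_decompositions[OF supports(1) supp_g]])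
      (use lim in blast)
  then show ?thesis
  proof (rule eventually_mono)
    fix n assume "\<forall>a\<in>?A. f n a = l a"
    then show "hmul (f n) g c = hmul l g c"
      unfolding hmul_eq_sum_supports[OF supports(1) supp_g supports(2) subset_refl]
        hmul_eq_sum_supports[OF supports(1) supp_g supports(3) subset_refl]
      by (intro sum.cong) auto
  qed
qed

end

section \<open>Units and additive maps of rings\<close>

definition unit_inverse :: "'r::comm_ring_1 \<Rightarrow> 'r" where
  "unit_inverse x = (THE y. x * y = 1)"

lemma unit_inverse_eqI:
  assumes "x * y = 1"
  shows "unit_inverse x = y"
  unfolding unit_inverse_def
proof (rule the_equality)
  show "z = y" if "x * z = 1" for z
    using assms that by (metis mult.assoc mult.commute mult_1)
qed (rule assms)

lemma mult_unit_inverse [simp]: "x dvd 1 \<Longrightarrow> x * unit_inverse x = 1"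
  unfolding dvd_def using unit_inverse_eqI by metis

lemma is_unit_mult: "x dvd 1 \<Longrightarrow> y dvd 1 \<Longrightarrow> x * y dvd (1 :: 'r::comm_ring_1)"
  using mult_dvd_mono[of x 1 y 1] by simp

lemma is_unit_unit_inverse: "x dvd 1 \<Longrightarrow> unit_inverse x dvd 1"
  using dvdI[of 1 "unit_inverse x" x] by (simp add: mult.commute)

lemma unit_inverse_mult:
  assumes "x dvd 1" "y dvd 1"
  shows "unit_inverse (x * y) = unit_inverse x * unit_inverse y"
proof (rule unit_inverse_eqI)
  have "x * y * (unit_inverse x * unit_inverse y) = (x * unit_inverse x) * (y * unit_inverse y)"
    by (simp only: mult_ac)
  then show "x * y * (unit_inverse x * unit_inverse y) = 1" using assms by simp
qed

definition zpow :: "'r::comm_ring_1 \<Rightarrow> int \<Rightarrow> 'r" where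
  "zpow x k = (if 0 \<le> k then x ^ nat k else unit_inverse x ^ nat (- k))"

lemma zpow_0 [simp]: "zpow x 0 = 1"
  by (simp add: zpow_def)

lemma zpow_add_one:
  assumes "x dvd 1"
  shows "zpow x (k + 1) = x * zpow x k"
proof (cases "0 \<le> k")
  case True
  then show ?thesis by (simp add: zpow_def nat_add_distrib)
next
  case False
  then have "nat (- k) = Suc (nat (- (k + 1)))" by simp
  then show ?thesis using False assms by (auto simp: zpow_def mult.assoc[symmetric])
qed

lemma is_unit_power: "x dvd 1 \<Longrightarrow> x ^ n dvd (1 :: 'r::comm_ring_1)"
  by (induction n) (simp_all add: is_unit_mult)

lemma is_unit_prod: "(\<And>i. i \<in> I \<Longrightarrow> f i dvd 1) \<Longrightarrow> (\<Prod>i\<in>I. f i) dvd (1 :: 'r::comm_ring_1)"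
  using prod_dvd_prod[of I f "\<lambda>_. 1"] by simp

lemma is_unit_zpow: "x dvd 1 \<Longrightarrow> zpow x k dvd 1"
  by (simp add: zpow_def is_unit_power is_unit_unit_inverse)

lemma additive_of_int_mult:
  fixes f :: "'a::ring_1 \<Rightarrow> 'b::ring_1"
  assumes "Modules.additive f"
  shows "f (of_int k * x) = of_int k * f x"
proof -
  interpret Modules.additive f by (rule assms)
  show ?thesis
    by (induction k rule: int_induct[of _ 0])
      (simp_all add: zero add diff distrib_right left_diff_distrib)
qed

section \<open>The ring of families of Hahn series\<close>

typedef (overloaded) 'a group_order = "{le :: 'a::ab_group_add \<Rightarrow> 'a \<Rightarrow> bool. po_group le}"
  morphisms leq Abs_group_order
  by (rule exI[of _ "(=)"]) (simp add: po_group_def)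

global_interpretation leq: po_group "leq r" for r :: "'a::ab_group_add group_order"
  using leq[of r] by simp

text \<open>A type cannot depend on an order that is a term, but the product of the rings of Hahn series
  over all orders is a type. This makes the determinants of \<open>HOL-Analysis\<close> available.\<close>

typedef (overloaded) ('a, 'k) hahn_family =
  "{X :: 'a::ab_group_add group_order \<Rightarrow> 'a \<Rightarrow> 'k::comm_ring_1.
    \<forall>r. almost_full_on (leq r) (hsupp (X r))}"
  morphisms component Abs_hahn_family
  by (rule exI[of _ "\<lambda>_ _. 0"]) (simp add: hsupp_def)

setup_lifting type_definition_hahn_family

instantiation hahn_family :: (ab_group_add, comm_ring_1) comm_ring_1
begin

lift_definition zero_hahn_family :: "('a, 'b) hahn_family" is "\<lambda>_ _. 0"
  by (simp add: hsupp_def)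

lift_definition one_hahn_family :: "('a, 'b) hahn_family" is "\<lambda>_. hone"
  by simp

lift_definition plus_hahn_family ::
    "('a, 'b) hahn_family \<Rightarrow> ('a, 'b) hahn_family \<Rightarrow> ('a, 'b) hahn_family"
  is "\<lambda>X Y r a. X r a + Y r a"
  by (blast intro: almost_full_on_subset[OF almost_full_on_Un hsupp_add])

lift_definition uminus_hahn_family :: "('a, 'b) hahn_family \<Rightarrow> ('a, 'b) hahn_family"
  is "\<lambda>X r a. - X r a"
  by (simp add: hsupp_def)

definition minus_hahn_family ::
    "('a, 'b) hahn_family \<Rightarrow> ('a, 'b) hahn_family \<Rightarrow> ('a, 'b) hahn_family" where
  "minus_hahn_family X Y = X + - Y"

lift_definition times_hahn_family ::
    "('a, 'b) hahn_family \<Rightarrow> ('a, 'b) hahn_family \<Rightarrow> ('a, 'b) hahn_family"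
  is "\<lambda>X Y r. hmul (X r) (Y r)"
  by (blast intro: leq.almost_full_on_hsupp_hmul)

instance
proof
  fix X Y Z :: "('a, 'b) hahn_family"
  show "X * Y * Z = X * (Y * Z)" by transfer (auto intro!: ext fun_cong[OF leq.hmul_assoc])
  show "X * Y = Y * X" by transfer (rule ext, rule hmul_commute)
  show "1 * X = X" by transfer simp
  show "(X + Y) * Z = X * Z + Y * Z" by transfer (auto intro!: ext fun_cong[OF leq.hmul_add_left])
  show "X + Y + Z = X + (Y + Z)" by transfer (simp add: add.assoc)
  show "X + Y = Y + X" by transfer (simp add: add.commute)
  show "0 + X = X" by transfer simp
  show "- X + X = 0" by transfer simp
  show "X - Y = X + - Y" by (rule minus_hahn_family_def)
  show "(0 :: ('a, 'b) hahn_family) \<noteq> 1" by transfer (auto simp: hone_def fun_eq_iff)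
qed

end

lemma hahn_family_eqI: "(\<And>r a. component X r a = component Y r a) \<Longrightarrow> X = Y"
  by transfer (simp add: fun_eq_iff)

lemma almost_full_on_component [simp]: "almost_full_on (leq r) (hsupp (component X r))"
  by transfer simp

lemma component_one [simp]: "component 1 r = hone"
  by transfer simp

lemma component_mult: "component (X * Y) r = hmul (component X r) (component Y r)"
  by transfer simp

lemma additive_component: "Modules.additive (\<lambda>X. component X r a)"
  by (rule Modules.additive.intro) (transfer, simp)

lemmas component_zero [simp] = Modules.additive.zero[OF additive_component]
  and component_add [simp] = Modules.additive.add[OF additive_component]
  and component_minus [simp] = Modules.additive.minus[OF additive_component]
  and component_diff [simp] = Modules.additive.diff[OF additive_component]
  and component_sum = Modules.additive.sum[OF additive_component]
  and component_of_int_mult = additive_of_int_mult[OF additive_component]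

lemma component_of_int: "component (of_int k) r a = of_int k * hone a"
  using component_of_int_mult[of k 1] by simp

lift_definition at_order ::
    "'a::ab_group_add group_order \<Rightarrow> ('a \<Rightarrow> 'k::comm_ring_1) \<Rightarrow> ('a, 'k) hahn_family"
  is "\<lambda>r f s. if s = r \<and> almost_full_on (leq r) (hsupp f) then f else (\<lambda>_. 0)"
  by (simp add: hsupp_def)

lemma component_at_order:
  "almost_full_on (leq r) (hsupp f) \<Longrightarrow> component (at_order r f) s = (if s = r then f else (\<lambda>_. 0))"
  by transfer simp

subsection \<open>Monomials and derivations\<close>

lift_definition hmonom :: "'k \<Rightarrow> 'a::ab_group_add \<Rightarrow> ('a, 'k::comm_ring_1) hahn_family"
  is "\<lambda>c a r b. if b = a then c else 0"
  by (rule almost_full_on_subset[OF leq.almost_full_on_singleton]) (auto simp: hsupp_def)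

lemma component_hmonom: "component (hmonom c a) r b = (if b = a then c else 0)"
  by transfer simp

lemma component_hmonom_mult: "component (hmonom c a * X) r b = c * component X r (b - a)"
  unfolding component_mult by (subst hmul_eq_sum[of "{a}"]) (auto simp: component_hmonom)

lemma hmonom_mult: "hmonom c a * hmonom d b = hmonom (c * d) (a + b)"
  by (rule hahn_family_eqI) (auto simp: component_hmonom_mult component_hmonom)

lemma hmonom_one_zero: "hmonom 1 0 = 1"
  by (rule hahn_family_eqI) (simp add: component_hmonom hone_def)

lemma hmonom_mult_inverse: "c dvd 1 \<Longrightarrow> hmonom c a * hmonom (unit_inverse c) (- a) = 1"
  by (simp add: hmonom_mult hmonom_one_zero)

lemma is_unit_hmonom: "c dvd 1 \<Longrightarrow> hmonom c a dvd 1"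
  using hmonom_mult_inverse by (metis dvdI)

lemma unit_inverse_hmonom: "c dvd 1 \<Longrightarrow> unit_inverse (hmonom c a) = hmonom (unit_inverse c) (- a)"
  by (intro unit_inverse_eqI hmonom_mult_inverse)

lift_definition hderiv ::
    "('a::ab_group_add \<Rightarrow> int) \<Rightarrow> ('a, 'k::comm_ring_1) hahn_family \<Rightarrow> ('a, 'k) hahn_family"
  is "\<lambda>d X r a. of_int (d a) * X r a"
  by (rule almost_full_on_subset[OF _ hsupp_mult]) blast

lemma component_hderiv [simp]: "component (hderiv d X) r a = of_int (d a) * component X r a"
  by transfer simp

lemma hderiv_add: "hderiv d (X + Y) = hderiv d X + hderiv d Y"
  by (rule hahn_family_eqI) (simp add: distrib_left)

lemma hderiv_mult:
  fixes X Y :: "('a::ab_group_add, 'k::comm_ring_1) hahn_family"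
  assumes "Modules.additive d"
  shows "hderiv d (X * Y) = hderiv d X * Y + X * hderiv d Y"
proof (rule hahn_family_eqI)
  fix r c
  let ?S = "hsupp (component X r)" and ?T = "hsupp (component Y r)"
  have sub: "hsupp (component (hderiv d X) r) \<subseteq> ?S" "hsupp (component (hderiv d Y) r) \<subseteq> ?T"
    by (auto simp: hsupp_def)
  note hmul_eq =
    leq.hmul_eq_sum_supports[of r ?S ?T, OF almost_full_on_component almost_full_on_component]
  have "of_int (d c) * (component X r a * component Y r (c - a)) =
      component (hderiv d X) r a * component Y r (c - a) +
      component X r a * component (hderiv d Y) r (c - a)" for a
  proof -
    have "of_int (d c) = (of_int (d a) + of_int (d (c - a)) :: 'k)"
      using additive.add[OF assms, of a "c - a"] by simp
    then show ?thesis by (simp add: algebra_simps)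
  qed
  then show "component (hderiv d (X * Y)) r c = component (hderiv d X * Y + X * hderiv d Y) r c"
    by (simp only: component_hderiv component_add component_mult hmul_eq[OF subset_refl subset_refl]
        hmul_eq[OF sub(1) subset_refl] hmul_eq[OF subset_refl sub(2)] sum_distrib_left sum.distrib)
qed

lemma hderiv_commute: "hderiv d (hderiv d' X) = hderiv d' (hderiv d X)"
  by (rule hahn_family_eqI) (simp add: mult_ac)

lemma hderiv_hmonom: "hderiv d (hmonom c a) = of_int (d a) * hmonom c a"
  by (rule hahn_family_eqI) (simp add: component_of_int_mult component_hmonom)

subsection \<open>Geometric series\<close>

definition positive_support :: "('a::ab_group_add, 'k::comm_ring_1) hahn_family \<Rightarrow> bool" where
  "positive_support \<epsilon> \<longleftrightarrow> (\<forall>r a. component \<epsilon> r a \<noteq> 0 \<longrightarrow> leq r 0 a \<and> a \<noteq> 0)"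

abbreviation support_monoid ::
    "('a::ab_group_add, 'k::comm_ring_1) hahn_family \<Rightarrow> 'a group_order \<Rightarrow> 'a set" where
  "support_monoid \<epsilon> r \<equiv> word_sums (hsupp (component \<epsilon> r))"

lemma
  assumes "positive_support \<epsilon>"
  shows almost_full_on_support_monoid: "almost_full_on (leq r) (support_monoid \<epsilon> r)"
    and finite_support_words_with_sum: "finite {w \<in> lists (hsupp (component \<epsilon> r)). sum_list w = a}"
  by (rule leq.neumann[OF almost_full_on_component];
      use assms in \<open>auto simp: positive_support_def hsupp_def\<close>)+

lemma hsupp_power:
  "hsupp (component (\<epsilon> ^ m) r) \<subseteq> sum_list ` {w \<in> lists (hsupp (component \<epsilon> r)). length w = m}"
proof (induction m)
  case 0
  show ?case using hsupp_hone_subset by (auto intro!: image_eqI[of _ _ "[]"])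
next
  case (Suc m)
  show ?case
  proof
    fix c assume "c \<in> hsupp (component (\<epsilon> ^ Suc m) r)"
    then have "c \<in> hsupp (component \<epsilon> r) + hsupp (component (\<epsilon> ^ m) r)"
      using hsupp_hmul by (auto simp: component_mult)
    then obtain a b where "c = a + b" "a \<in> hsupp (component \<epsilon> r)" "b \<in> hsupp (component (\<epsilon> ^ m) r)"
      by (rule set_plus_elim)
    moreover from this(3) Suc obtain w
      where "b = sum_list w" "w \<in> lists (hsupp (component \<epsilon> r))" "length w = m"
      by blast
    ultimately show "c \<in> sum_list ` {w \<in> lists (hsupp (component \<epsilon> r)). length w = Suc m}"
      by (auto intro!: image_eqI[of _ _ "a # w"])
  qed
qed

lemma hsupp_power_subset: "hsupp (component (\<epsilon> ^ m) r) \<subseteq> support_monoid \<epsilon> r"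
  using hsupp_power[of \<epsilon> m r] by (auto simp: word_sums_def)

lemma hsupp_sum_power_subset:
  "hsupp (component (\<Sum>i<n. \<epsilon> ^ i) r) \<subseteq> support_monoid \<epsilon> r"
proof
  fix a assume "a \<in> hsupp (component (\<Sum>i<n. \<epsilon> ^ i) r)"
  then obtain i where "component (\<epsilon> ^ i) r a \<noteq> 0"
    unfolding hsupp_def component_sum by (auto elim: sum.not_neutral_contains_not_neutral)
  then show "a \<in> support_monoid \<epsilon> r" using hsupp_power_subset by (auto simp: hsupp_def)
qed

lemma eventually_power_eq_0:
  assumes "positive_support \<epsilon>"
  shows "\<forall>\<^sub>F m in sequentially. component (\<epsilon> ^ m) r a = 0"
proof -
  let ?words = "{w \<in> lists (hsupp (component \<epsilon> r)). sum_list w = a}"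
  have "finite (length ` ?words)"
    by (intro finite_imageI finite_support_words_with_sum assms)
  then obtain N where length_less_N: "length w < N" if "w \<in> ?words" for w
    by (auto simp: finite_nat_set_iff_bounded)
  have "component (\<epsilon> ^ m) r a = 0" if "m \<ge> N" for m
  proof (rule ccontr)
    assume "component (\<epsilon> ^ m) r a \<noteq> 0"
    then have "a \<in> hsupp (component (\<epsilon> ^ m) r)" by (simp add: hsupp_def)
    then obtain w where "w \<in> ?words" "length w = m" using hsupp_power by blast
    then show False using length_less_N that by fastforce
  qed
  then show ?thesis unfolding eventually_sequentially by blast
qed

lemma eventually_component_mult_eq:
  assumes "almost_full_on (leq r) S" "\<And>n. hsupp (component (Z n) r) \<subseteq> S" "hsupp (component Y r) \<subseteq> S"
    and "\<And>a. \<forall>\<^sub>F n in F. component (Z n) r a = component Y r a"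
  shows "\<forall>\<^sub>F n in F. component (Z n * X) r c = component (Y * X) r c"
  unfolding component_mult using assms by (intro leq.eventually_hmul_eq) auto

lemma eventually_power_mult_eq_0:
  assumes "positive_support \<epsilon>"
  shows "\<forall>\<^sub>F m in sequentially. component (\<epsilon> ^ m * X) r a = 0"
  using eventually_component_mult_eq[OF almost_full_on_support_monoid[OF assms] hsupp_power_subset,
      where Y = 0 and F = sequentially and X = X and c = a] eventually_power_eq_0[OF assms]
  by (simp add: hsupp_def)

lemma hahn_family_limit:
  fixes Z :: "nat \<Rightarrow> ('a::ab_group_add, 'k::comm_ring_1) hahn_family"
  assumes "\<And>r. almost_full_on (leq r) (S r)" "\<And>n r. hsupp (component (Z n) r) \<subseteq> S r"
    and "\<And>r a. \<exists>c. \<forall>\<^sub>F n in sequentially. component (Z n) r a = c"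
  obtains Y where "\<And>r. hsupp (component Y r) \<subseteq> S r"
    and "\<And>r a. \<forall>\<^sub>F n in sequentially. component (Z n) r a = component Y r a"
proof -
  obtain y where lim: "\<And>r a. \<forall>\<^sub>F n in sequentially. component (Z n) r a = y r a"
    using assms(3) by metis
  have supp_y: "hsupp (y r) \<subseteq> S r" for r
  proof
    fix a assume "a \<in> hsupp (y r)"
    moreover obtain n where "component (Z n) r a = y r a"
      using eventually_happens[OF lim] by auto
    ultimately show "a \<in> S r" using assms(2)[of n r] by (auto simp: hsupp_def)
  qed
  then have "component (Abs_hahn_family y) = y"
    using assms(1) by (intro Abs_hahn_family_inverse) (auto intro: almost_full_on_subset)
  then show ?thesis using that[of "Abs_hahn_family y"] lim supp_y by simp
qed

lemma geometric_series_converges: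
  fixes \<epsilon> :: "('a::ab_group_add, 'k::comm_ring_1) hahn_family"
  assumes "positive_support \<epsilon>"
  obtains Y where "\<And>r. hsupp (component Y r) \<subseteq> support_monoid \<epsilon> r"
    and "\<And>r a. \<forall>\<^sub>F n in sequentially. component (\<Sum>i<n. \<epsilon> ^ i) r a = component Y r a"
proof (rule hahn_family_limit[of "support_monoid \<epsilon>" "\<lambda>n. \<Sum>i<n. \<epsilon> ^ i"])
  show "almost_full_on (leq r) (support_monoid \<epsilon> r)" for r
    by (rule almost_full_on_support_monoid[OF assms])
  show "hsupp (component (\<Sum>i<n. \<epsilon> ^ i) r) \<subseteq> support_monoid \<epsilon> r" for n r
    by (rule hsupp_sum_power_subset)
  show "\<exists>c. \<forall>\<^sub>F n in sequentially. component (\<Sum>i<n. \<epsilon> ^ i) r a = c" for r a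
  proof -
    obtain N where vanish: "\<And>i. i \<ge> N \<Longrightarrow> component (\<epsilon> ^ i) r a = 0"
      using eventually_power_eq_0[OF assms] unfolding eventually_sequentially by blast
    have "component (\<Sum>i<n. \<epsilon> ^ i) r a = component (\<Sum>i<N. \<epsilon> ^ i) r a" if "n \<ge> N" for n
      using that by (induction n rule: dec_induct) (simp_all add: vanish)
    then show ?thesis unfolding eventually_sequentially by blast
  qed
qed (rule that)

lemma one_minus_positive_support_inverse:
  fixes \<epsilon> :: "('a::ab_group_add, 'k::comm_ring_1) hahn_family"
  assumes "positive_support \<epsilon>"
  obtains Y where "(1 - \<epsilon>) * Y = 1" "\<And>r. hsupp (component Y r) \<subseteq> support_monoid \<epsilon> r"
proof -
  obtain Y where supp_Y: "\<And>r. hsupp (component Y r) \<subseteq> support_monoid \<epsilon> r"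
    and lim: "\<And>r a. \<forall>\<^sub>F n in sequentially. component (\<Sum>i<n. \<epsilon> ^ i) r a = component Y r a"
    by (rule geometric_series_converges[OF assms]) (rule that)
  have "Y * (1 - \<epsilon>) = 1"
  proof (rule hahn_family_eqI)
    fix r c
    have telescope: "1 - \<epsilon> ^ n = (\<Sum>i<n. \<epsilon> ^ i) * (1 - \<epsilon>)" for n
      by (simp add: one_diff_power_eq mult.commute)
    have "\<forall>\<^sub>F n in sequentially. component (1 - \<epsilon> ^ n) r c = component (Y * (1 - \<epsilon>)) r c"
      unfolding telescope
      by (rule eventually_component_mult_eq
          [OF almost_full_on_support_monoid[OF assms] hsupp_sum_power_subset supp_Y lim])
    moreover have "\<forall>\<^sub>F n in sequentially. component (1 - \<epsilon> ^ n) r c = component 1 r c"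
      using eventually_power_eq_0[OF assms, of r c] by eventually_elim simp
    ultimately have "\<forall>\<^sub>F n in sequentially. component (Y * (1 - \<epsilon>)) r c = component 1 r c"
      by eventually_elim simp
    then show "component (Y * (1 - \<epsilon>)) r c = component 1 r c" by simp
  qed
  then show ?thesis using that[of Y] supp_Y by (simp add: mult.commute)
qed

lemma
  assumes "positive_support \<epsilon>"
  shows is_unit_one_plus: "1 + \<epsilon> dvd 1"
    and hsupp_unit_inverse_one_plus:
      "hsupp (component (unit_inverse (1 + \<epsilon>)) r) \<subseteq> support_monoid \<epsilon> r"
proof -
  have "positive_support (- \<epsilon>)" using assms by (simp add: positive_support_def)
  then obtain Y where "(1 - - \<epsilon>) * Y = 1"
    and "\<And>r. hsupp (component Y r) \<subseteq> support_monoid (- \<epsilon>) r"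
    by (rule one_minus_positive_support_inverse) (rule that)
  then have inverse: "(1 + \<epsilon>) * Y = 1"
    and supp: "\<And>r. hsupp (component Y r) \<subseteq> support_monoid \<epsilon> r"
    by (simp_all add: hsupp_def)
  show "1 + \<epsilon> dvd 1" using inverse[symmetric] by (rule dvdI)
  show "hsupp (component (unit_inverse (1 + \<epsilon>)) r) \<subseteq> support_monoid \<epsilon> r"
    unfolding unit_inverse_eqI[OF inverse] by (rule supp)
qed

section \<open>Determinants with a replaced row\<close>

definition replace_row :: "'r^'n^'m \<Rightarrow> 'm \<Rightarrow> 'r^'n \<Rightarrow> 'r^'n^'m" where
  "replace_row A i v = (\<chi> l. if l = i then v else A $ l)"

lemma replace_row_nth: "replace_row A i v $ l = (if l = i then v else A $ l)"
  by (simp add: replace_row_def)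

lemma replace_row_same [simp]: "replace_row A i (A $ i) = A"
  by (simp add: replace_row_def vec_eq_iff)

lemma replace_row_commute:
  "i \<noteq> j \<Longrightarrow> replace_row (replace_row A i v) j w = replace_row (replace_row A j w) i v"
  by (simp add: replace_row_def vec_eq_iff)

context
  fixes A :: "'r::comm_ring_1^'n^'n"
begin

lemma det_replace_row_add:
  "det (replace_row A i (v + w)) = det (replace_row A i v) + det (replace_row A i w)"
  unfolding replace_row_def by (rule det_row_add)

lemma det_replace_row_smult: "det (replace_row A i (c *s v)) = c * det (replace_row A i v)"
  unfolding replace_row_def by (rule det_row_mul)

lemma det_replace_row_0 [simp]: "det (replace_row A i 0) = 0"
  unfolding replace_row_def by (rule det_row_0)

lemma det_replace_row_sum:
  "det (replace_row A i (\<Sum>l\<in>S. v l)) = (\<Sum>l\<in>S. det (replace_row A i (v l)))"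
  by (induction S rule: infinite_finite_induct) (simp_all add: det_replace_row_add)

lemma det_replace_row_other:
  assumes "m \<noteq> i"
  shows "det (replace_row A i (A $ m)) = 0"
  by (rule det_identical_rows[OF assms]) (use assms in \<open>simp add: row_def replace_row_def\<close>)

lemma det_replace_row_combination:
  "det (replace_row A i (\<Sum>m\<in>UNIV. k m *s A $ m)) = k i * det A"
proof -
  have "det (replace_row A i (\<Sum>m\<in>UNIV. k m *s A $ m)) =
      (\<Sum>m\<in>UNIV. k m * det (replace_row A i (A $ m)))"
    by (simp add: det_replace_row_sum det_replace_row_smult)
  also have "\<dots> = (\<Sum>m\<in>{i}. k m * det (replace_row A i (A $ m)))"
    by (rule sum.mono_neutral_right) (simp_all add: det_replace_row_other)
  finally show ?thesis by simp
qed

lemma det_replace_row_expansion: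
  "det (replace_row A i v) = (\<Sum>j\<in>UNIV. v $ j * det (replace_row A i (axis j 1)))"
proof -
  have "det (replace_row A i v) = det (replace_row A i (\<Sum>j\<in>UNIV. v $ j *s axis j 1))"
    by (simp add: basis_expansion)
  then show ?thesis by (simp add: det_replace_row_sum det_replace_row_smult)
qed

end

lemma det_replace_two_rows_same:
  fixes A :: "'r::comm_ring_1^'n^'n"
  assumes "i \<noteq> m"
  shows "det (replace_row (replace_row A i v) m v) = 0"
  by (rule det_identical_rows[OF assms]) (use assms in \<open>simp add: row_def replace_row_def\<close>)

lemma det_replace_two_rows_swap:
  fixes A :: "'r::comm_ring_1^'n^'n"
  assumes "i \<noteq> m"
  shows "det (replace_row (replace_row A i v) m w) = - det (replace_row (replace_row A i w) m v)"
proof -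
  have split: "det (replace_row (replace_row A i (v + w)) m z) =
      det (replace_row (replace_row A i v) m z) + det (replace_row (replace_row A i w) m z)" for z
    using assms by (simp add: replace_row_commute[of i m] det_replace_row_add)
  have "det (replace_row (replace_row A i (v + w)) m (v + w)) = 0"
    by (rule det_replace_two_rows_same[OF assms])
  then show ?thesis
    by (simp add: det_replace_row_add split det_replace_two_rows_same[OF assms] eq_neg_iff_add_eq_0
        add.commute)
qed

lemma rows_independent_if_det_nonzero:
  fixes A :: "'r::idom^'n^'n"
  assumes "det A \<noteq> 0" "(\<Sum>i\<in>UNIV. k i *s A $ i) = 0"
  shows "k i = 0"
  using det_replace_row_combination[of A i k] assms by simp

section \<open>Commuting derivations\<close>

lemma sum_symmetric_times_alternating:
  fixes s a :: "'i \<Rightarrow> 'i \<Rightarrow> 'r::comm_ring"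
  assumes "\<And>i j. s i j = s j i" "\<And>i. a i i = 0" "\<And>i j. a i j = - a j i"
  shows "(\<Sum>i\<in>S. \<Sum>j\<in>S. s i j * a i j) = 0"
proof (induction S rule: infinite_finite_induct)
  case (insert x S)
  have "(\<Sum>i\<in>S. s i x * a i x) = (\<Sum>j\<in>S. - (s x j * a x j))"
    by (rule sum.cong) (simp_all add: assms(1)[of _ x] assms(3)[of _ x])
  then show ?case
    using insert by (simp add: sum.distrib assms(2) sum_negf)
qed simp_all

locale commuting_derivations =
  fixes D :: "'n::finite \<Rightarrow> 'r::comm_ring_1 \<Rightarrow> 'r"
  assumes D_add: "D j (x + y) = D j x + D j y"
    and D_mult: "D j (x * y) = D j x * y + x * D j y"
    and D_commute: "D i (D j x) = D j (D i x)"
begin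

sublocale D: Modules.additive "D j" for j
  by unfold_locales (rule D_add)

lemma D_one [simp]: "D j 1 = 0"
  using D_mult[of j 1 1] by simp

lemma D_of_int [simp]: "D j (of_int k) = 0"
  using additive_of_int_mult[OF D.additive_axioms, of j k 1] by simp

lemma D_prod:
  assumes "finite S"
  shows "D j (\<Prod>l\<in>S. f l) = (\<Sum>m\<in>S. D j (f m) * (\<Prod>l\<in>S - {m}. f l))"
  using assms
proof (induction S rule: finite_induct)
  case (insert a S)
  have "(\<Sum>m\<in>S. D j (f m) * (\<Prod>l\<in>insert a S - {m}. f l)) =
      (\<Sum>m\<in>S. f a * (D j (f m) * (\<Prod>l\<in>S - {m}. f l)))"
  proof (rule sum.cong[OF refl])
    fix m assume "m \<in> S"
    then have "insert a S - {m} = insert a (S - {m})" "a \<notin> S - {m}" using insert by auto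
    then show "D j (f m) * (\<Prod>l\<in>insert a S - {m}. f l) = f a * (D j (f m) * (\<Prod>l\<in>S - {m}. f l))"
      using insert(1) by (simp add: mult_ac)
  qed
  moreover have "insert a S - {a} = S" using insert by auto
  ultimately show ?case using insert by (simp add: D_mult sum_distrib_left)
qed simp

lemma D_det:
  fixes A :: "'r^'m^'m"
  shows "D j (det A) = (\<Sum>m\<in>UNIV. det (replace_row A m (\<chi> l. D j (A $ m $ l))))"
proof -
  let ?P = "{p. p permutes (UNIV :: 'm set)}"
  have "D j (det A) =
      (\<Sum>p\<in>?P. of_int (sign p) * (\<Sum>m\<in>UNIV. D j (A $ m $ p m) * (\<Prod>l\<in>UNIV - {m}. A $ l $ p l)))"
    by (simp add: det_def D.sum D_mult D_prod)
  also have "\<dots> = (\<Sum>m\<in>UNIV. \<Sum>p\<in>?P.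
      of_int (sign p) * (D j (A $ m $ p m) * (\<Prod>l\<in>UNIV - {m}. A $ l $ p l)))"
    unfolding sum_distrib_left by (rule sum.swap)
  also have "\<dots> = (\<Sum>m\<in>UNIV. det (replace_row A m (\<chi> l. D j (A $ m $ l))))"
  proof (rule sum.cong[OF refl])
    fix m
    have "(\<Prod>l\<in>UNIV. replace_row A m (\<chi> l. D j (A $ m $ l)) $ l $ p l) =
        D j (A $ m $ p m) * (\<Prod>l\<in>UNIV - {m}. A $ l $ p l)" for p
      by (subst prod.remove[of _ m]) (auto simp: replace_row_nth intro!: prod.cong)
    then show "(\<Sum>p\<in>?P. of_int (sign p) * (D j (A $ m $ p m) * (\<Prod>l\<in>UNIV - {m}. A $ l $ p l))) =
        det (replace_row A m (\<chi> l. D j (A $ m $ l)))"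
      by (simp add: det_def)
  qed
  finally show ?thesis .
qed

definition grad :: "'r \<Rightarrow> 'r^'n" where
  "grad x = (\<chi> j. D j x)"

definition closed_row :: "'r^'n \<Rightarrow> bool" where
  "closed_row v \<longleftrightarrow> (\<forall>j l. D j (v $ l) = D l (v $ j))"

lemma piola_identity:
  assumes closed: "\<And>m. m \<noteq> i \<Longrightarrow> closed_row (A $ m)"
  shows "(\<Sum>j\<in>UNIV. D j (det (replace_row A i (axis j 1)))) = 0"
proof -
  define minor where "minor m j l = det (replace_row (replace_row A i (axis j 1)) m (axis l 1))"
    for m j l
  have D_cofactor: "D j (det (replace_row A i (axis j 1))) =
      (\<Sum>m\<in>UNIV - {i}. \<Sum>l\<in>UNIV. D j (A $ m $ l) * minor m j l)" for j
  proof -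
    let ?B = "replace_row A i (axis j 1)"
    have "(\<chi> l. D j (?B $ i $ l)) = 0"
      by (simp add: vec_eq_iff replace_row_nth axis_def D.zero)
    then have "D j (det ?B) = (\<Sum>m\<in>UNIV - {i}. det (replace_row ?B m (\<chi> l. D j (?B $ m $ l))))"
      unfolding D_det by (subst sum.remove[of _ i]) simp_all
    also have "\<dots> = (\<Sum>m\<in>UNIV - {i}. \<Sum>l\<in>UNIV. D j (A $ m $ l) * minor m j l)"
      by (rule sum.cong[OF refl], subst det_replace_row_expansion)
        (simp add: replace_row_nth minor_def)
    finally show ?thesis .
  qed
  have "(\<Sum>j\<in>UNIV. \<Sum>l\<in>UNIV. D j (A $ m $ l) * minor m j l) = 0" if "m \<in> UNIV - {i}" for m
  proof (rule sum_symmetric_times_alternating)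
    have "i \<noteq> m" using that by simp
    then show "D j (A $ m $ l) = D l (A $ m $ j)" "minor m j j = 0"
      and "minor m j l = - minor m l j" for j l
      using closed[of m] det_replace_two_rows_same det_replace_two_rows_swap
      by (simp_all add: closed_row_def minor_def)
  qed
  then show ?thesis
    unfolding D_cofactor by (subst sum.swap) simp
qed

lemma det_exact_row_eq_divergence:
  assumes "\<And>m. m \<noteq> i \<Longrightarrow> closed_row (A $ m)"
  shows "det (replace_row A i (grad \<psi>)) =
    (\<Sum>j\<in>UNIV. D j (\<psi> * det (replace_row A i (axis j 1))))"
  unfolding det_replace_row_expansion[of A i "grad \<psi>"]
  by (simp add: D_mult sum.distrib sum_distrib_left[symmetric] piola_identity[OF assms] grad_def)

subsection \<open>Logarithmic derivatives\<close>

definition dlog :: "'r \<Rightarrow> 'r^'n" where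
  "dlog x = unit_inverse x *s grad x"

lemma grad_eq_dlog: "x dvd 1 \<Longrightarrow> grad x = x *s dlog x"
  by (simp add: dlog_def vector_smult_assoc)

lemma dlog_one [simp]: "dlog 1 = 0"
  by (simp add: dlog_def grad_def vec_eq_iff)

lemma dlog_mult:
  assumes "x dvd 1" "y dvd 1"
  shows "dlog (x * y) = dlog x + dlog y"
proof -
  have "unit_inverse (x * y) * (D j x * y + x * D j y) =
      (y * unit_inverse y) * (unit_inverse x * D j x) +
      (x * unit_inverse x) * (unit_inverse y * D j y)" for j
    unfolding unit_inverse_mult[OF assms] by (simp add: algebra_simps)
  then show ?thesis
    using assms by (simp add: dlog_def grad_def vec_eq_iff D_mult)
qed

lemma dlog_unit_inverse:
  assumes "x dvd 1"
  shows "dlog (unit_inverse x) = - dlog x"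
  using dlog_mult[OF assms is_unit_unit_inverse[OF assms]] assms
  by (simp add: eq_neg_iff_add_eq_0 add.commute)

lemma dlog_power: "x dvd 1 \<Longrightarrow> dlog (x ^ n) = of_nat n *s dlog x"
  by (induction n) (simp_all add: dlog_mult is_unit_power vector_sadd_rdistrib)

lemma dlog_zpow:
  assumes "x dvd 1"
  shows "dlog (zpow x k) = of_int k *s dlog x"
  using assms by (simp add: zpow_def dlog_power is_unit_unit_inverse dlog_unit_inverse vec_eq_iff)

lemma dlog_prod:
  "(\<And>i. i \<in> I \<Longrightarrow> f i dvd 1) \<Longrightarrow> dlog (\<Prod>i\<in>I. f i) = (\<Sum>i\<in>I. dlog (f i))"
  by (induction I rule: infinite_finite_induct) (simp_all add: dlog_mult is_unit_prod)

lemma closed_row_dlog: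
  assumes "x dvd 1"
  shows "closed_row (dlog x)"
  unfolding closed_row_def
proof (intro allI)
  fix j l
  have "D j (unit_inverse x) = unit_inverse x * - dlog x $ j" for j
    using arg_cong[OF grad_eq_dlog[OF is_unit_unit_inverse[OF assms]], of "\<lambda>v. v $ j"]
    by (simp add: grad_def dlog_unit_inverse[OF assms])
  then show "D j (dlog x $ l) = D l (dlog x $ j)"
    by (simp add: dlog_def grad_def D_mult D_commute[of j l] mult_ac)
qed

definition log_jacobian :: "('n \<Rightarrow> 'r) \<Rightarrow> 'r" where
  "log_jacobian F = det (\<chi> i. dlog (F i))"

end

definition monomial :: "('n::finite \<Rightarrow> 'r::comm_ring_1) \<Rightarrow> int^'n \<Rightarrow> 'r" where
  "monomial F k = (\<Prod>i\<in>UNIV. zpow (F i) (k $ i))"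

lemma monomial_0 [simp]: "monomial F 0 = 1"
  by (simp add: monomial_def)

section \<open>Residue functionals\<close>

locale residue_functional = commuting_derivations D + L: Modules.additive L
  for D :: "'n::finite \<Rightarrow> 'r::comm_ring_1 \<Rightarrow> 'r" and L :: "'r \<Rightarrow> 's::ring_1" +
  assumes L_D: "L (D j x) = 0"
    and torsion_free: "of_int k * s = 0 \<Longrightarrow> k = 0 \<or> s = (0 :: 's)"
begin

lemma L_eq_0_if_multiple:
  assumes "L (of_int k * x) = 0" "k \<noteq> 0"
  shows "L x = 0"
  using assms torsion_free additive_of_int_mult[OF L.additive_axioms] by metis

lemma L_det_exact_row:
  assumes "\<And>m. m \<noteq> i \<Longrightarrow> closed_row (A $ m)"
  shows "L (det (replace_row A i (grad \<psi>))) = 0"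
  by (simp add: det_exact_row_eq_divergence[OF assms] L.sum L_D)

lemma L_monomial_log_jacobian_eq_0:
  assumes units: "\<And>l. F l dvd 1" and "k \<noteq> 0"
  shows "L (monomial F k * log_jacobian F) = 0"
proof -
  obtain i where k_i: "k $ i \<noteq> 0" using \<open>k \<noteq> 0\<close> by (auto simp: vec_eq_iff)
  define A where "A = (\<chi> l. dlog (F l))"
  have "grad (monomial F k) = monomial F k *s dlog (monomial F k)"
    unfolding monomial_def by (intro grad_eq_dlog is_unit_prod is_unit_zpow units)
  also have "dlog (monomial F k) = (\<Sum>m\<in>UNIV. of_int (k $ m) *s A $ m)"
    by (simp add: monomial_def dlog_prod is_unit_zpow units dlog_zpow A_def)
  finally have "det (replace_row A i (grad (monomial F k))) =
      of_int (k $ i) * (monomial F k * det A)"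
    by (simp add: det_replace_row_smult det_replace_row_combination)
  moreover have "closed_row (A $ m)" for m by (simp add: A_def closed_row_dlog units)
  ultimately have "L (of_int (k $ i) * (monomial F k * det A)) = 0"
    using L_det_exact_row[of i A "monomial F k"] by simp
  then show ?thesis
    using L_eq_0_if_multiple k_i unfolding A_def log_jacobian_def by blast
qed

definition L_nilpotent :: "'r \<Rightarrow> bool" where
  "L_nilpotent x \<longleftrightarrow> (\<forall>y. \<exists>m. L (x ^ m * y) = 0)"

lemma L_det_dlog_row_eq_0:
  assumes unipotent: "u dvd 1" "L_nilpotent (u - 1)"
    and closed: "\<And>m. m \<noteq> i \<Longrightarrow> closed_row (A $ m)"
  shows "L (det (replace_row A i (dlog u))) = 0"
proof -
  let ?d = "det (replace_row A i (dlog u))"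
  have positive_power: "L (u ^ m * ?d) = 0" if "m > 0" for m
  proof -
    have "grad (u ^ m) = (of_int (int m) * u ^ m) *s dlog u"
      using grad_eq_dlog[OF is_unit_power[OF unipotent(1)], of m]
      by (simp add: dlog_power unipotent(1) vector_smult_assoc mult.commute)
    then have "L (of_int (int m) * (u ^ m * ?d)) = 0"
      using L_det_exact_row[OF closed, where \<psi> = "u ^ m"]
      by (simp add: det_replace_row_smult mult.assoc)
    then show ?thesis using L_eq_0_if_multiple that by (metis of_nat_0_less_iff less_irrefl)
  qed
  obtain M where vanish: "L ((u - 1) ^ M * ?d) = 0"
    using unipotent(2) unfolding L_nilpotent_def by blast
  define c where "c m = int (M choose m) * (- 1) ^ (M - m)" for m
  have "(u - 1) ^ M = (\<Sum>m\<le>M. of_int (c m) * u ^ m)"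
    using binomial_ring[of u "- 1" M] by (simp add: c_def mult_ac)
  then have "L ((u - 1) ^ M * ?d) = (\<Sum>m\<le>M. L (of_int (c m) * (u ^ m * ?d)))"
    by (simp add: sum_distrib_right L.sum mult.assoc)
  also have "\<dots> = (\<Sum>m\<in>{0}. L (of_int (c m) * (u ^ m * ?d)))"
    by (rule sum.mono_neutral_right)
      (auto simp: positive_power additive_of_int_mult[OF L.additive_axioms])
  finally have "L (of_int (c 0) * ?d) = 0" using vanish by simp
  moreover have "c 0 \<noteq> 0" by (simp add: c_def)
  ultimately show ?thesis by (rule L_eq_0_if_multiple)
qed

lemma L_log_jacobian_mult:
  fixes f u :: "'n \<Rightarrow> 'r"
  assumes units: "\<And>l. f l dvd 1" and unipotent: "\<And>l. u l dvd 1" "\<And>l. L_nilpotent (u l - 1)"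
  shows "L (log_jacobian (\<lambda>l. f l * u l)) = L (log_jacobian f)"
proof -
  define A where "A S = (\<chi> l. if l \<in> S then dlog (f l * u l) else dlog (f l))" for S
  have "L (det (A S)) = L (log_jacobian f)" if "finite S" for S
    using that
  proof (induction S rule: finite_induct)
    case empty
    show ?case by (simp add: A_def log_jacobian_def)
  next
    case (insert i S)
    have "A (insert i S) = replace_row (A S) i (A S $ i + dlog (u i))"
      using insert(2) units unipotent(1) by (auto simp: A_def replace_row_def vec_eq_iff dlog_mult)
    then have "det (A (insert i S)) = det (A S) + det (replace_row (A S) i (dlog (u i)))"
      by (simp add: det_replace_row_add)
    moreover have "closed_row (A S $ l)" for l
      using units unipotent(1) by (simp add: A_def closed_row_dlog is_unit_mult)
    ultimately show ?case
      using insert(3) by (simp add: L.add L_det_dlog_row_eq_0[OF unipotent])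
  qed
  from this[of UNIV] show ?thesis by (simp add: A_def log_jacobian_def)
qed

end

section \<open>Constant terms of logarithmic Jacobians\<close>

lemma hmonom_prod: "(\<Prod>i\<in>I. hmonom (c i) (a i)) = hmonom (\<Prod>i\<in>I. c i) (\<Sum>i\<in>I. a i)"
  by (induction I rule: infinite_finite_induct) (simp_all add: hmonom_one_zero hmonom_mult)

definition hvar :: "'n::finite \<Rightarrow> ('g::ab_group_add \<times> (int^'n), 'k::comm_ring_1) hahn_family" where
  "hvar j = hmonom 1 (0, axis j 1)"

lemma is_unit_hvar: "hvar j dvd 1"
  unfolding hvar_def by (rule is_unit_hmonom) simp

lemma unit_inverse_hvar: "unit_inverse (hvar j) = hmonom 1 (- (0, axis j 1))"
  unfolding hvar_def by (simp add: unit_inverse_hmonom unit_inverse_eqI)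

lemma prod_unit_inverse_hvar:
  "(\<Prod>j\<in>UNIV. unit_inverse (hvar j)) =
    (hmonom 1 (0, - 1) :: ('g::ab_group_add \<times> (int^'n), 'k::comm_ring_1) hahn_family)"
proof -
  have "(\<Sum>j\<in>UNIV. - (0, axis j 1)) = (0 :: 'g, - 1 :: int^'n)"
    by (simp add: prod_eq_iff fst_sum snd_sum vec_eq_iff sum_component axis_def sum_negf)
  then show ?thesis by (simp add: unit_inverse_hvar hmonom_prod)
qed

definition euler_deriv ::
    "'n::finite \<Rightarrow> ('g::ab_group_add \<times> (int^'n), 'k::comm_ring_1) hahn_family \<Rightarrow>
      ('g \<times> (int^'n), 'k) hahn_family"
  where "euler_deriv j = hderiv (\<lambda>a. snd a $ j)"

global_interpretation euler: commuting_derivations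
  "euler_deriv :: 'n::finite \<Rightarrow> ('g::ab_group_add \<times> (int^'n), 'k::comm_ring_1) hahn_family \<Rightarrow> _"
proof
  have "Modules.additive (\<lambda>a :: 'g \<times> (int^'n). snd a $ j)" for j
    by (rule Modules.additive.intro) simp
  then show "euler_deriv j (X * Y) = euler_deriv j X * Y + X * euler_deriv j Y"
    for j :: 'n and X Y :: "('g \<times> (int^'n), 'k) hahn_family"
    unfolding euler_deriv_def by (rule hderiv_mult)
qed (simp_all add: euler_deriv_def hderiv_add hderiv_commute)

lemma dlog_hmonom:
  assumes "c dvd 1"
  shows "euler.dlog (hmonom c a) = (\<chi> j. of_int (snd a $ j))"
proof -
  have "unit_inverse (hmonom c a) * (of_int m * hmonom c a) =
      of_int m * (hmonom c a * unit_inverse (hmonom c a))" for m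
    by (simp only: mult_ac)
  then show ?thesis
    using is_unit_hmonom[OF assms, of a]
    by (simp add: euler.dlog_def euler.grad_def euler_deriv_def hderiv_hmonom vec_eq_iff)
qed

lemma log_jacobian_hmonom:
  assumes "\<And>i. c i dvd 1"
  shows "euler.log_jacobian (\<lambda>i. hmonom (c i) (a i)) = of_int (det (\<chi> i. snd (a i)))"
  by (simp add: euler.log_jacobian_def dlog_hmonom assms det_def)

definition jacobian_family ::
    "('n::finite \<Rightarrow> ('g::ab_group_add \<times> (int^'n), 'k::comm_ring_1) hahn_family) \<Rightarrow>
      ('g \<times> (int^'n), 'k) hahn_family"
  where "jacobian_family F = det (\<chi> i j. unit_inverse (hvar j) * euler_deriv j (F i))"

lemma jacobian_family_eq_log_jacobian:
  assumes "\<And>i. F i dvd 1"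
  shows "jacobian_family F = hmonom 1 (0, - 1) * ((\<Prod>i\<in>UNIV. F i) * euler.log_jacobian F)"
proof -
  define A where "A = (\<chi> i. F i *s euler.dlog (F i))"
  have A_nth: "A $ i $ j = euler_deriv j (F i)" for i j
    unfolding A_def by (simp add: euler.grad_eq_dlog[OF assms, symmetric] euler.grad_def)
  have "jacobian_family F = det (\<chi> j. unit_inverse (hvar j) *s transpose A $ j)"
    unfolding jacobian_family_def
    by (subst det_transpose[symmetric]) (simp add: transpose_def A_nth vector_scalar_mult_def)
  also have "\<dots> = (\<Prod>j\<in>UNIV. unit_inverse (hvar j)) * det A"
    by (simp add: det_rows_mul det_transpose)
  also have "det A = (\<Prod>i\<in>UNIV. F i) * euler.log_jacobian F"
    unfolding A_def euler.log_jacobian_def by (rule det_rows_mul)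
  finally show ?thesis by (simp add: prod_unit_inverse_hvar)
qed

locale leading_monomials =
  fixes c :: "'n::finite \<Rightarrow> 'k::comm_ring_1" and a :: "'n \<Rightarrow> 'g::ab_group_add \<times> (int^'n)"
    and \<epsilon> :: "'n \<Rightarrow> ('g \<times> (int^'n), 'k) hahn_family"
  assumes torsion_free: "of_int m * s = 0 \<Longrightarrow> m = 0 \<or> s = (0 :: 'k)"
    and is_unit_c: "c i dvd 1"
    and positive_support_\<epsilon>: "positive_support (\<epsilon> i)"
begin

definition F :: "'n \<Rightarrow> ('g \<times> (int^'n), 'k) hahn_family" where
  "F i = hmonom (c i) (a i) * (1 + \<epsilon> i)"

lemma is_unit_F: "F i dvd 1"
  unfolding F_def
  by (intro is_unit_mult is_unit_hmonom is_unit_one_plus is_unit_c positive_support_\<epsilon>)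

theorem CT_monomial_log_jacobian:
  "component (monomial F k * euler.log_jacobian F) r (g, 0) =
    of_int (if k = 0 \<and> g = 0 then det (\<chi> i. snd (a i)) else 0)"
proof -
  interpret CT: residue_functional euler_deriv
    "\<lambda>X :: ('g \<times> (int^'n), 'k) hahn_family. component X r (g, 0)"
  proof unfold_locales
    show "component (euler_deriv j X) r (g, 0) = 0"
      for j :: 'n and X :: "('g \<times> (int^'n), 'k) hahn_family"
      by (simp add: euler_deriv_def)
  qed (simp_all add: torsion_free)
  show ?thesis
  proof (cases "k = 0")
    case True
    have "CT.L_nilpotent (\<epsilon> i)" for i
      unfolding CT.L_nilpotent_def
      using eventually_happens[OF eventually_power_mult_eq_0[OF positive_support_\<epsilon>]]
      by (metis sequentially_bot)
    then have "component (euler.log_jacobian F) r (g, 0) =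
        component (euler.log_jacobian (\<lambda>i. hmonom (c i) (a i))) r (g, 0)"
      unfolding F_def
      by (intro CT.L_log_jacobian_mult is_unit_hmonom is_unit_one_plus is_unit_c
          positive_support_\<epsilon>) simp
    also have "\<dots> = of_int (det (\<chi> i. snd (a i))) * hone (g, 0 :: int^'n)"
      by (simp add: log_jacobian_hmonom is_unit_c component_of_int)
    finally show ?thesis using True by (simp add: hone_def zero_prod_def)
  qed (simp add: CT.L_monomial_log_jacobian_eq_0 is_unit_F)
qed

theorem Res_monomial_jacobian:
  "component (monomial F k * jacobian_family F) r (g, - 1) =
    of_int (if k = - 1 \<and> g = 0 then det (\<chi> i. snd (a i)) else 0)"
proof -
  have "monomial F (k + 1) = (\<Prod>i\<in>UNIV. F i) * monomial F k"
    by (simp add: monomial_def zpow_add_one[OF is_unit_F] prod.distrib)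
  then have "monomial F k * jacobian_family F =
      hmonom 1 (0, - 1) * (monomial F (k + 1) * euler.log_jacobian F)"
    by (simp add: jacobian_family_eq_log_jacobian[OF is_unit_F] mult_ac)
  then have "component (monomial F k * jacobian_family F) r (g, - 1) =
      component (monomial F (k + 1) * euler.log_jacobian F) r (g, 0)"
    by (simp add: component_hmonom_mult)
  also have "k + 1 = 0 \<longleftrightarrow> k = - 1" by (rule add_eq_0_iff2)
  ultimately show ?thesis unfolding CT_monomial_log_jacobian by simp
qed

definition tail_exponents :: "('g \<times> (int^'n)) group_order \<Rightarrow> ('g \<times> (int^'n)) set" where
  "tail_exponents r = (\<Union>i. hsupp (component (\<epsilon> i) r))"

lemma almost_full_on_tail_monoid: "almost_full_on (leq r) (word_sums (tail_exponents r))"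
proof (rule leq.almost_full_on_word_sums)
  show "almost_full_on (leq r) (tail_exponents r)"
    unfolding tail_exponents_def by (intro almost_full_on_finite_UN) simp_all
  fix e assume "e \<in> tail_exponents r"
  then obtain i where "component (\<epsilon> i) r e \<noteq> 0" by (auto simp: tail_exponents_def hsupp_def)
  then show "leq r 0 e \<and> e \<noteq> 0"
    using positive_support_\<epsilon>[of i] unfolding positive_support_def by blast
qed

definition supported_from ::
    "('g \<times> (int^'n)) group_order \<Rightarrow> 'g \<times> (int^'n) \<Rightarrow> ('g \<times> (int^'n), 'k) hahn_family \<Rightarrow> bool" where
  "supported_from r b X \<longleftrightarrow> (\<forall>d. component X r d \<noteq> 0 \<longrightarrow> d - b \<in> word_sums (tail_exponents r))"

lemma supported_from_one: "supported_from r 0 1"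
  by (auto simp: supported_from_def hone_def)

lemma supported_from_hmonom: "supported_from r b (hmonom d b)"
  by (simp add: supported_from_def component_hmonom)

lemma supported_from_mult:
  assumes "supported_from r b X" "supported_from r b' Y"
  shows "supported_from r (b + b') (X * Y)"
  unfolding supported_from_def
proof (intro allI impI)
  fix d assume "component (X * Y) r d \<noteq> 0"
  then have "d \<in> hsupp (component X r) + hsupp (component Y r)"
    using hsupp_hmul[of "component X r" "component Y r"] by (auto simp: component_mult hsupp_def)
  then obtain e e' where "d = e + e'" "component X r e \<noteq> 0" "component Y r e' \<noteq> 0"
    by (auto simp: hsupp_def elim: set_plus_elim)
  then have "(e - b) + (e' - b') \<in> word_sums (tail_exponents r)"
    using assms unfolding supported_from_def by (intro word_sums_add) blast+
  then show "d - (b + b') \<in> word_sums (tail_exponents r)"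
    using \<open>d = e + e'\<close> by (simp add: algebra_simps)
qed

lemma supported_from_prod:
  "(\<And>i. i \<in> I \<Longrightarrow> supported_from r (b i) (X i)) \<Longrightarrow>
    supported_from r (\<Sum>i\<in>I. b i) (\<Prod>i\<in>I. X i)"
  by (induction I rule: infinite_finite_induct)
    (simp_all add: supported_from_one supported_from_mult)

lemma supported_from_F: "supported_from r (a i) (F i)"
proof -
  have "supported_from r 0 (1 + \<epsilon> i)"
    unfolding supported_from_def
  proof (intro allI impI)
    fix d assume in_support: "component (1 + \<epsilon> i) r d \<noteq> 0"
    show "d - 0 \<in> word_sums (tail_exponents r)"
    proof (cases "d = 0")
      case False
      then have "d \<in> tail_exponents r"
        using in_support by (auto simp: tail_exponents_def hsupp_def hone_def)
      then show ?thesis using subset_word_sums by auto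
    qed simp
  qed
  from supported_from_mult[OF supported_from_hmonom this] show ?thesis by (simp add: F_def)
qed

lemma supported_from_unit_inverse_F: "supported_from r (- a i) (unit_inverse (F i))"
proof -
  have "support_monoid (\<epsilon> i) r \<subseteq> word_sums (tail_exponents r)"
    by (rule word_sums_mono) (auto simp: tail_exponents_def)
  then have "supported_from r 0 (unit_inverse (1 + \<epsilon> i))"
    using hsupp_unit_inverse_one_plus[OF positive_support_\<epsilon>, of i r] by (auto simp: supported_from_def hsupp_def)
  from supported_from_mult[OF supported_from_hmonom this] show ?thesis
    by (simp add: F_def unit_inverse_mult is_unit_hmonom is_unit_one_plus unit_inverse_hmonom
        is_unit_c positive_support_\<epsilon>)
qed

lemma supported_from_monomial: "supported_from r (\<Sum>i\<in>UNIV. zmul (k $ i) (a i)) (monomial F k)"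
proof -
  have power: "supported_from r (\<Sum>_\<in>{0..<m}. b) (X ^ m)" if "supported_from r b X" for b X m
    using supported_from_prod[of "{0..<m}" r "\<lambda>_. b" "\<lambda>_. X"] that by simp
  have "supported_from r (zmul m (a i)) (zpow (F i) m)" for i m
    using power[OF supported_from_F, where m = "nat m"]
      power[OF supported_from_unit_inverse_F, where m = "nat (- m)"]
    by (simp add: zpow_def zmul_def sum_negf)
  then show ?thesis unfolding monomial_def by (intro supported_from_prod)
qed

end

section \<open>A torsion-free cover of the coefficient field\<close>

typedef 'k mult_monoid = "UNIV :: 'k set"
  by simp

setup_lifting type_definition_mult_monoid

instantiation mult_monoid :: (comm_monoid_mult) comm_monoid_add
begin

lift_definition zero_mult_monoid :: "'a mult_monoid" is 1 .

lift_definition plus_mult_monoid :: "'a mult_monoid \<Rightarrow> 'a mult_monoid \<Rightarrow> 'a mult_monoid" is "(*)" .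

instance
  by standard (transfer; simp add: mult_ac)+

end

lemma Rep_mult_monoid_zero [simp]: "Rep_mult_monoid 0 = 1"
  by transfer simp

lemma Rep_mult_monoid_add [simp]: "Rep_mult_monoid (x + y) = Rep_mult_monoid x * Rep_mult_monoid y"
  by transfer simp

type_synonym 'k cover = "'k mult_monoid \<Rightarrow>\<^sub>0 int"

definition cover_eval :: "'k::comm_ring_1 cover \<Rightarrow> 'k" where
  "cover_eval p = (\<Sum>m\<in>Poly_Mapping.keys p. of_int (Poly_Mapping.lookup p m) * Rep_mult_monoid m)"

lemma cover_eval_superset:
  assumes "finite S" "Poly_Mapping.keys p \<subseteq> S"
  shows "cover_eval p = (\<Sum>m\<in>S. of_int (Poly_Mapping.lookup p m) * Rep_mult_monoid m)"
  unfolding cover_eval_def by (rule sum.mono_neutral_left) (use assms in \<open>auto simp: in_keys_iff\<close>)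

lemma cover_eval_single [simp]:
  "cover_eval (Poly_Mapping.single m k) = of_int k * Rep_mult_monoid m"
  by (subst cover_eval_superset[of "{m}"]) auto

lemma cover_eval_one [simp]: "cover_eval 1 = 1"
  using cover_eval_single[of 0 1] by (simp del: cover_eval_single)

lemma additive_cover_eval: "Modules.additive cover_eval"
proof
  fix p q :: "'k::comm_ring_1 cover"
  let ?S = "Poly_Mapping.keys p \<union> Poly_Mapping.keys q"
  have "Poly_Mapping.keys (p + q) \<subseteq> ?S" by (rule Poly_Mapping.keys_add)
  then show "cover_eval (p + q) = cover_eval p + cover_eval q"
    by (simp add: cover_eval_superset[of ?S] lookup_add distrib_right sum.distrib)
qed

lemmas cover_eval_zero [simp] = Modules.additive.zero[OF additive_cover_eval]
  and cover_eval_sum = Modules.additive.sum[OF additive_cover_eval]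
  and cover_eval_of_int_mult = additive_of_int_mult[OF additive_cover_eval]

lemma cover_eval_of_int [simp]: "cover_eval (of_int k) = of_int k"
  using cover_eval_of_int_mult[of k 1] by simp

lemma poly_mapping_eq_sum_single:
  "p = (\<Sum>m\<in>Poly_Mapping.keys p. Poly_Mapping.single m (Poly_Mapping.lookup p m))"
  by (rule poly_mapping_eqI) (simp add: lookup_sum lookup_single when_def in_keys_iff)

lemma cover_eval_mult: "cover_eval (p * q) = cover_eval p * cover_eval q"
proof -
  have "p * q = (\<Sum>m\<in>Poly_Mapping.keys p. Poly_Mapping.single m (Poly_Mapping.lookup p m)) *
      (\<Sum>m\<in>Poly_Mapping.keys q. Poly_Mapping.single m (Poly_Mapping.lookup q m))"
    by (simp only: poly_mapping_eq_sum_single[symmetric])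
  also have "\<dots> = (\<Sum>m\<in>Poly_Mapping.keys p. \<Sum>n\<in>Poly_Mapping.keys q.
      Poly_Mapping.single (m + n) (Poly_Mapping.lookup p m * Poly_Mapping.lookup q n))"
    by (simp add: sum_product mult_single)
  finally show ?thesis
    by (simp add: cover_eval_sum cover_eval_def[of p] cover_eval_def[of q] sum_product mult_ac)
qed

lemma cover_torsion_free:
  fixes p :: "'k::comm_ring_1 cover"
  assumes "of_int k * p = 0"
  shows "k = 0 \<or> p = 0"
proof (cases "k = 0")
  case False
  have "of_int k = (Poly_Mapping.single 0 k :: 'k cover)"
    by (metis of_int_eq_id id_apply single_of_int)
  then have "of_int k * p = Poly_Mapping.map ((*) k) p"
    by (simp add: mult_map_scale_conv_mult)
  then have "k * Poly_Mapping.lookup p m = Poly_Mapping.lookup (of_int k * p) m" for m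
    by (simp add: Poly_Mapping.map.rep_eq when_def)
  then have "k * Poly_Mapping.lookup p m = 0" for m using assms by simp
  then have "Poly_Mapping.lookup p m = 0" for m using False by simp
  then show ?thesis by (simp add: poly_mapping_eqI)
qed simp

definition cover_lift :: "'k::comm_ring_1 \<Rightarrow> 'k cover" where
  "cover_lift c = (if c = 0 then 0 else Poly_Mapping.single (Abs_mult_monoid c) 1)"

lemma cover_eval_lift [simp]: "cover_eval (cover_lift c) = c"
  by (simp add: cover_lift_def Abs_mult_monoid_inverse)

lemma cover_lift_eq_0_iff [simp]: "cover_lift c = 0 \<longleftrightarrow> c = 0"
  using cover_eval_lift[of c] by (auto simp: cover_lift_def simp del: cover_eval_lift)

lemma is_unit_cover_lift:
  assumes "c * d = 1"
  shows "cover_lift c dvd 1"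
proof -
  have "c \<noteq> 0" "d \<noteq> 0" using assms by auto
  moreover have "Abs_mult_monoid c + Abs_mult_monoid d = 0"
    using assms by (simp add: Rep_mult_monoid_inject[symmetric] Abs_mult_monoid_inverse)
  ultimately have "cover_lift c * cover_lift d = 1" by (simp add: cover_lift_def mult_single)
  then show ?thesis by (metis dvdI)
qed

subsection \<open>Reduction of coefficients\<close>

definition reduce ::
    "'a::ab_group_add group_order \<Rightarrow> ('a, 'k::comm_ring_1 cover) hahn_family \<Rightarrow> 'a \<Rightarrow> 'k" where
  "reduce r X = (\<lambda>a. cover_eval (component X r a))"

lemma hsupp_reduce: "hsupp (reduce r X) \<subseteq> hsupp (component X r)"
  by (auto simp: hsupp_def reduce_def)

lemma almost_full_on_reduce [simp]: "almost_full_on (leq r) (hsupp (reduce r X))"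
  by (rule almost_full_on_subset[OF almost_full_on_component hsupp_reduce])

lemma reduce_one [simp]: "reduce r 1 = hone"
  by (auto simp: reduce_def hone_def)

lemma reduce_mult: "reduce r (X * Y) = hmul (reduce r X) (reduce r Y)"
proof
  fix c
  note supports = almost_full_on_component[of r X] almost_full_on_component[of r Y]
  show "reduce r (X * Y) c = hmul (reduce r X) (reduce r Y) c"
    unfolding leq.hmul_eq_sum_supports[OF supports hsupp_reduce hsupp_reduce]
    unfolding reduce_def component_mult
      leq.hmul_eq_sum_supports[OF supports subset_refl subset_refl]
    by (simp add: cover_eval_sum cover_eval_mult)
qed

lemma additive_reduce: "Modules.additive (\<lambda>X. reduce r X a)"
  by (rule Modules.additive.intro)
    (simp add: reduce_def Modules.additive.add[OF additive_cover_eval])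

lemma hprod_reduce:
  fixes X :: "'n::finite \<Rightarrow> ('a::ab_group_add, 'k::field cover) hahn_family"
  shows "hprod (\<lambda>i. reduce r (X i)) = reduce r (\<Prod>i\<in>UNIV. X i)"
proof -
  define xs where "xs = (SOME xs. distinct xs \<and> set xs = (UNIV :: 'n set))"
  have "\<exists>xs. distinct xs \<and> set xs = (UNIV :: 'n set)"
    using finite_distinct_list[OF finite_class.finite_UNIV] by blast
  then have xs_enumeration: "distinct xs" "set xs = UNIV"
    unfolding xs_def by (metis (mono_tags, lifting) someI_ex)+
  have "foldr hmul (map (\<lambda>i. reduce r (X i)) ys) hone = reduce r (prod_list (map X ys))" for ys
    by (induction ys) (simp_all add: reduce_mult)
  then show ?thesis
    using prod.distinct_set_conv_list[OF xs_enumeration(1), of X] xs_enumeration(2)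
    by (simp add: hprod_def xs_def[symmetric])
qed

lemma hdet_reduce: "hdet (\<lambda>i j. reduce r (M $ i $ j)) = reduce r (det M)"
  by (rule ext) (simp add: hdet_def det_def hprod_reduce Modules.additive.sum[OF additive_reduce]
      additive_of_int_mult[OF additive_reduce])

lemma hpderiv_reduce:
  fixes X :: "('g::ab_group_add \<times> (int^'n::finite), 'k::field cover) hahn_family"
  shows "hpderiv j (reduce r X) = reduce r (unit_inverse (hvar j) * euler_deriv j X)"
proof
  fix b :: "'g \<times> (int^'n)"
  obtain g h where b_eq: "b = (g, h)" by force
  have "reduce r (unit_inverse (hvar j) * euler_deriv j X) (g, h) =
      cover_eval (of_int (h $ j + 1) * component X r (g, h + axis j 1))"
    by (simp add: reduce_def unit_inverse_hvar euler_deriv_def component_hmonom_mult)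
  also have "\<dots> = of_int (h $ j + 1) * reduce r X (g, h + axis j 1)"
    by (simp only: reduce_def cover_eval_of_int_mult)
  finally show "hpderiv j (reduce r X) b = reduce r (unit_inverse (hvar j) * euler_deriv j X) b"
    by (simp add: b_eq hpderiv_def)
qed

lemma jacobian_reduce: "jacobian (\<lambda>i. reduce r (X i)) = reduce r (jacobian_family X)"
  unfolding jacobian_def jacobian_family_def hdet_reduce[symmetric] by (simp add: hpderiv_reduce)

lemma xvar_reduce: "xvar j = reduce r (hvar j)"
  by (auto simp: xvar_def tpow_def reduce_def hvar_def component_hmonom)

section \<open>Totally ordered groups\<close>

locale toa_group =
  fixes le :: "'a::ab_group_add \<Rightarrow> 'a \<Rightarrow> bool" (infix "\<preceq>" 50)
  assumes toa: "toa le"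
begin

sublocale po_group
  using toa unfolding toa_def by unfold_locales blast+

lemma le_total: "a \<preceq> b \<or> b \<preceq> a"
  using toa unfolding toa_def by blast

lemma wo_on_iff_almost_full_on: "wo_on le S \<longleftrightarrow> almost_full_on (\<preceq>) S"
proof
  assume "wo_on le S"
  show "almost_full_on (\<preceq>) S"
  proof (rule almost_full_onI)
    fix f :: "nat \<Rightarrow> 'a"
    assume "\<And>n. f n \<in> S"
    then have "range f \<subseteq> S" "range f \<noteq> {}" by auto
    then obtain m where "m \<in> range f" "\<forall>x\<in>range f. m \<preceq> x"
      using \<open>wo_on le S\<close> unfolding wo_on_def by blast
    then obtain i where "f i \<preceq> f (Suc i)" by blast
    then show "\<exists>i j. i < j \<and> f i \<preceq> f j" using lessI by blast
  qed
next
  assume almost_full: "almost_full_on (\<preceq>) S"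
  show "wo_on le S"
    unfolding wo_on_def
  proof (intro allI impI, rule ccontr)
    fix T assume T: "T \<subseteq> S" "T \<noteq> {}" and "\<not> (\<exists>m\<in>T. \<forall>x\<in>T. m \<preceq> x)"
    then have "\<exists>y. y \<in> T \<and> \<not> x \<preceq> y" if "x \<in> T" for x using that by blast
    then have "\<exists>f. \<forall>n::nat. f n \<in> T \<and> \<not> f n \<preceq> f (Suc n)"
      using T(2) by (intro dependent_nat_choice) auto
    then obtain f where descending: "f n \<in> T" "\<not> f n \<preceq> f (Suc n)" for n :: nat by blast
    have antimono: "f n \<preceq> f m" if "m \<le> n" for m n
      using that
    proof (induction n rule: dec_induct)
      case (step n)
      then show ?case using descending(2)[of n] le_total le_trans by blast
    qed simp
    obtain i j where "i < j" "f i \<preceq> f j"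
      by (rule almost_full_onD[OF almost_full, of f]) (use descending(1) T(1) in blast)
    then have "f i \<preceq> f (Suc i)" using antimono[of "Suc i" j] le_trans by simp
    then show False using descending(2) by blast
  qed
qed

lemma hahn_iff: "f \<in> hahn le \<longleftrightarrow> almost_full_on (\<preceq>) (hsupp f)"
  by (simp add: hahn_def wo_on_iff_almost_full_on)

lemma init_exp_eqI:
  assumes "a \<in> hsupp f" "\<And>b. b \<in> hsupp f \<Longrightarrow> a \<preceq> b"
  shows "init_exp le f = a"
  unfolding init_exp_def using assms by (intro the_equality) (auto intro: le_antisym)

lemma init_exp_least:
  assumes "f \<in> hahn le" "f \<noteq> (\<lambda>_. 0)"
  shows "init_exp le f \<in> hsupp f" "b \<in> hsupp f \<Longrightarrow> init_exp le f \<preceq> b"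
proof -
  have "hsupp f \<noteq> {}" using assms(2) by (auto simp: hsupp_def)
  then obtain m where m_least: "m \<in> hsupp f" "\<forall>x\<in>hsupp f. m \<preceq> x"
    using assms(1) unfolding hahn_def wo_on_def by blast
  then have "init_exp le f = m" by (intro init_exp_eqI) auto
  then show "init_exp le f \<in> hsupp f" "b \<in> hsupp f \<Longrightarrow> init_exp le f \<preceq> b" using m_least by auto
qed

definition le_order :: "'a group_order" where
  "le_order = Abs_group_order le"

lemma leq_le_order [simp]: "leq le_order = le"
  unfolding le_order_def by (rule Abs_group_order_inverse) (simp add: po_group_axioms)

lemma almost_full_on_reduce_le_order [simp]: "almost_full_on (\<preceq>) (hsupp (reduce le_order X))"
  using almost_full_on_reduce[of le_order] by simp

lemma hinv_reduce:
  fixes X :: "('a, 'k::field cover) hahn_family"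
  assumes "X dvd 1"
  shows "hinv le (reduce le_order X) = reduce le_order (unit_inverse X)"
  unfolding hinv_def
proof (rule the_equality)
  have inverse: "hmul (reduce le_order X) (reduce le_order (unit_inverse X)) = hone"
    using assms by (simp add: reduce_mult[symmetric])
  then show "reduce le_order (unit_inverse X) \<in> hahn le \<and>
      hmul (reduce le_order X) (reduce le_order (unit_inverse X)) = hone"
    by (simp add: hahn_iff)
  fix g assume g_inverse: "g \<in> hahn le \<and> hmul (reduce le_order X) g = hone"
  have "g = hmul (hmul (reduce le_order (unit_inverse X)) (reduce le_order X)) g"
    using inverse by (simp add: hmul_commute)
  also have "\<dots> = hmul (reduce le_order (unit_inverse X)) (hmul (reduce le_order X) g)"
    using g_inverse by (intro hmul_assoc) (auto simp: hahn_iff)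
  finally show "g = reduce le_order (unit_inverse X)"
    using g_inverse by (simp add: hmul_commute[of _ hone])
qed

lemma hpow_reduce:
  fixes X :: "('a, 'k::field cover) hahn_family"
  assumes "X dvd 1"
  shows "hpow le (reduce le_order X) k = reduce le_order (zpow X k)"
proof -
  have "(hmul (reduce le_order Z) ^^ m) hone = reduce le_order (Z ^ m)"
    for Z :: "('a, 'k cover) hahn_family" and m
    by (induction m) (simp_all add: reduce_mult)
  then show ?thesis by (simp add: hpow_def zpow_def hinv_reduce[OF assms])
qed

end

locale toa_group_with_variables = toa_group le
  for le :: "'g::ab_group_add \<times> (int^'n::finite) \<Rightarrow> 'g \<times> (int^'n) \<Rightarrow> bool" (infix "\<preceq>" 50)
begin

lemma xinit_eq:
  assumes "f \<in> hahn le" "f \<noteq> (\<lambda>_. 0)"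
  shows "xinit le f = snd (init_exp le f)"
proof -
  define a where "a = init_exp le f"
  have a_least: "a \<in> hsupp f" "\<And>b. b \<in> hsupp f \<Longrightarrow> a \<preceq> b"
    using init_exp_least[OF assms] by (auto simp: a_def)
  have hsupp_slice: "hsupp (xslice f k) = {b \<in> hsupp f. snd b = k}" for k
    by (auto simp: hsupp_def xslice_def split: if_splits)
  have "xslice f k \<in> hahn le" for k
    using assms(1) unfolding hahn_iff hsupp_slice by (rule almost_full_on_subset) auto
  then have slice: "init_exp le (xslice f k) \<in> hsupp f \<and> snd (init_exp le (xslice f k)) = k"
    if "xslice f k \<noteq> (\<lambda>_. 0)" for k
    using init_exp_least(1)[of "xslice f k"] that by (simp add: hsupp_slice)
  have init_slice: "init_exp le (xslice f (snd a)) = a"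
    by (rule init_exp_eqI) (use a_least in \<open>auto simp: hsupp_slice\<close>)
  have slice_nonzero: "xslice f (snd a) \<noteq> (\<lambda>_. 0)"
    using a_least(1) hsupp_slice[of "snd a"] by (auto simp: hsupp_def)
  show ?thesis
    unfolding xinit_def a_def[symmetric]
  proof (rule the_equality)
    show "xslice f (snd a) \<noteq> (\<lambda>_. 0) \<and> (\<forall>k'. xslice f k' \<noteq> (\<lambda>_. 0) \<longrightarrow>
        init_exp le (xslice f (snd a)) \<preceq> init_exp le (xslice f k'))"
      using slice_nonzero slice a_least(2) unfolding init_slice by blast
    fix k assume k_initial: "xslice f k \<noteq> (\<lambda>_. 0) \<and> (\<forall>k'. xslice f k' \<noteq> (\<lambda>_. 0) \<longrightarrow>
        init_exp le (xslice f k) \<preceq> init_exp le (xslice f k'))"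
    then have "init_exp le (xslice f k) \<preceq> a" using slice_nonzero init_slice by metis
    then have "init_exp le (xslice f k) = a" using slice k_initial a_least(2) le_antisym by blast
    then show "k = snd a" using slice k_initial by metis
  qed
qed

lemma Fpow_reduce:
  fixes X :: "'n \<Rightarrow> ('g \<times> (int^'n), 'k::field cover) hahn_family"
  assumes "\<And>i. X i dvd 1"
  shows "Fpow le (\<lambda>i. reduce le_order (X i)) k = reduce le_order (monomial X k)"
  by (simp add: Fpow_def monomial_def hpow_reduce[OF assms] hprod_reduce)

lemma logjacobian_reduce:
  fixes X :: "'n \<Rightarrow> ('g \<times> (int^'n), 'k::field cover) hahn_family"
  assumes "\<And>i. X i dvd 1"
  shows "logjacobian le (\<lambda>i. reduce le_order (X i)) = reduce le_order (euler.log_jacobian X)"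
proof -
  let ?vars = "\<Prod>j\<in>UNIV. hvar j :: ('g \<times> (int^'n), 'k cover) hahn_family"
  let ?X = "\<Prod>i\<in>UNIV. X i"
  have "?X dvd 1" by (intro is_unit_prod assms)
  have "hprod xvar = reduce le_order ?vars"
    unfolding hprod_reduce[symmetric] by (simp add: xvar_reduce[symmetric])
  then have "logjacobian le (\<lambda>i. reduce le_order (X i)) =
      reduce le_order (?vars * unit_inverse ?X * jacobian_family X)"
    unfolding logjacobian_def hprod_reduce jacobian_reduce hinv_reduce[OF \<open>?X dvd 1\<close>] reduce_mult
    by simp
  also have "?vars * unit_inverse ?X * jacobian_family X =
      (?vars * hmonom 1 (0, - 1)) * (?X * unit_inverse ?X) * euler.log_jacobian X"
    unfolding jacobian_family_eq_log_jacobian[OF assms] by (simp only: mult_ac)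
  also have "?vars * hmonom 1 (0, - 1) = 1"
    unfolding prod_unit_inverse_hvar[symmetric] prod.distrib[symmetric] by (simp add: is_unit_hvar)
  finally show ?thesis using \<open>?X dvd 1\<close> by simp
qed

end

section \<open>The residue theorem\<close>

lemma fst_zmul: "fst (zmul k a) = zmul k (fst a)"
  by (simp add: zmul_def fst_sum)

lemma snd_zmul: "snd (zmul k a) = k *s (snd a :: int^'n)"
  by (simp add: zmul_def snd_sum vec_eq_iff sum_component del: sum_constant) simp

lemma fendo_eq_sum: "fendo le F (g, k) = (g, 0) + (\<Sum>i\<in>UNIV. zmul (k $ i) (init_exp le (F i)))"
  by (simp add: fendo_def prod_eq_iff fst_sum snd_sum fst_zmul snd_zmul)

lemma fendo_split: "fendo le F (g, k) = (g, 0) + fendo le F (0, k)"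
  by (simp add: fendo_def prod_eq_iff)

locale residue_setting = toa_group_with_variables le
  for le :: "'g::ab_group_add \<times> (int^'n::finite) \<Rightarrow> 'g \<times> (int^'n) \<Rightarrow> bool" (infix "\<preceq>" 50) +
  fixes F :: "'n \<Rightarrow> 'g \<times> (int^'n) \<Rightarrow> 'k::field"
  assumes F_hahn: "\<And>i. F i \<in> hahn le" and F_nonzero: "\<And>i. F i \<noteq> (\<lambda>_. 0)"
    and jacnum_nonzero: "jacnum le F \<noteq> 0"
begin

abbreviation lead :: "'n \<Rightarrow> 'g \<times> (int^'n)" where
  "lead i \<equiv> init_exp le (F i)"

lemma lead_coeff_nonzero: "F i (lead i) \<noteq> 0"
  and lead_least: "F i b \<noteq> 0 \<Longrightarrow> lead i \<preceq> b"
  using init_exp_least[OF F_hahn[of i] F_nonzero[of i]] by (auto simp: hsupp_def)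

lemma jacnum_eq: "jacnum le F = det (\<chi> i. snd (lead i))"
  by (simp add: jacnum_def xinit_eq F_hahn F_nonzero vec_lambda_eta)

lemma inj_fendo: "inj (fendo le F)"
proof (rule injI)
  fix p q assume eq: "fendo le F p = fendo le F q"
  obtain g h g' h' where pq_eq: "p = (g, h)" "q = (g', h')" by force
  have "(\<Sum>i\<in>UNIV. h $ i *s snd (lead i)) = (\<Sum>i\<in>UNIV. h' $ i *s snd (lead i))"
    using eq by (simp add: pq_eq fendo_def)
  then have "(\<Sum>i\<in>UNIV. (h $ i - h' $ i) *s (\<chi> i. snd (lead i)) $ i) = 0"
    by (simp add: vector_sub_rdistrib sum_subtractf)
  then have "h $ i - h' $ i = 0" for i
    using jacnum_nonzero unfolding jacnum_eq
    by (rule rows_independent_if_det_nonzero[rotated, where k = "\<lambda>i. h $ i - h' $ i"])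
  then have "h = h'" by (simp add: vec_eq_iff)
  then show "p = q" using eq by (simp add: pq_eq fendo_def)
qed

definition tail :: "'n \<Rightarrow> 'g \<times> (int^'n) \<Rightarrow> 'k cover" where
  "tail i b = (if b = 0 then 0 else cover_lift (F i (b + lead i) / F i (lead i)))"

lemma almost_full_on_tail: "almost_full_on (\<preceq>) (hsupp (tail i))"
proof (rule almost_full_on_subset)
  show "almost_full_on (\<preceq>) (hsupp (F i) + {- lead i})"
    using F_hahn by (intro almost_full_on_set_plus) (simp_all add: hahn_iff)
  show "hsupp (tail i) \<subseteq> hsupp (F i) + {- lead i}"
  proof
    fix b assume "b \<in> hsupp (tail i)"
    then have "b + lead i \<in> hsupp (F i)" by (auto simp: hsupp_def tail_def split: if_splits)
    then have "(b + lead i) + - lead i \<in> hsupp (F i) + {- lead i}" by (rule set_plus_intro) simp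
    then show "b \<in> hsupp (F i) + {- lead i}" by simp
  qed
qed

lemma component_tail:
  "component (at_order le_order (tail i)) r = (if r = le_order then tail i else (\<lambda>_. 0))"
  by (rule component_at_order) (simp add: almost_full_on_tail)

sublocale lifted: leading_monomials
  "\<lambda>i. cover_lift (F i (lead i))" lead "\<lambda>i. at_order le_order (tail i)"
proof
  show "of_int m * s = 0 \<Longrightarrow> m = 0 \<or> s = 0" for m and s :: "'k cover" by (rule cover_torsion_free)
  show "cover_lift (F i (lead i)) dvd 1" for i
    using lead_coeff_nonzero by (intro is_unit_cover_lift[of _ "inverse (F i (lead i))"]) simp
  show "positive_support (at_order le_order (tail i))" for i
    unfolding positive_support_def
  proof (intro allI impI)
    fix r b assume "component (at_order le_order (tail i)) r b \<noteq> 0"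
    then have "r = le_order" "b \<noteq> 0" "F i (b + lead i) \<noteq> 0"
      by (auto simp: component_tail tail_def split: if_splits)
    moreover from this(3) have "0 + lead i \<preceq> b + lead i" using lead_least by simp
    ultimately show "leq r 0 b \<and> b \<noteq> 0" by (auto simp only: leq_le_order le_add_cancel_right)
  qed
qed

lemma reduce_lifted: "reduce le_order (lifted.F i) = F i"
proof
  fix b
  have "reduce le_order (lifted.F i) b =
      F i (lead i) * cover_eval (hone (b - lead i) + tail i (b - lead i))"
    by (simp add: reduce_def lifted.F_def component_hmonom_mult component_tail cover_eval_mult)
  then show "reduce le_order (lifted.F i) b = F i b"
    using lead_coeff_nonzero[of i] by (cases "b = lead i") (simp_all add: hone_def tail_def)
qed

lemma jacobian_eq: "jacobian F = reduce le_order (jacobian_family lifted.F)"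
  using jacobian_reduce[of le_order lifted.F] by (simp add: reduce_lifted)

lemma logjacobian_eq: "logjacobian le F = reduce le_order (euler.log_jacobian lifted.F)"
  using logjacobian_reduce[OF lifted.is_unit_F] by (simp add: reduce_lifted)

lemma subst_terms_eq:
  "subst_terms le Phi F k = hmul (xcoeff Phi k) (reduce le_order (monomial lifted.F k))"
  using Fpow_reduce[OF lifted.is_unit_F] by (simp add: subst_terms_def reduce_lifted)

abbreviation tail_monoid :: "('g \<times> (int^'n)) set" where
  "tail_monoid \<equiv> word_sums (lifted.tail_exponents le_order)"

lemma almost_full_on_tail_monoid: "almost_full_on (\<preceq>) tail_monoid"
  using lifted.almost_full_on_tail_monoid[of le_order] by simp

lemma subst_terms_supp:
  assumes "subst_terms le Phi F k c \<noteq> 0"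
  obtains g where "Phi (g, k) \<noteq> 0" "c - fendo le F (g, k) \<in> tail_monoid"
proof -
  have "c \<in> hsupp (xcoeff Phi k) + hsupp (reduce le_order (monomial lifted.F k))"
    using assms hsupp_hmul by (auto simp: hsupp_def subst_terms_eq)
  then obtain a b where c_eq: "c = a + b" and a_supp: "a \<in> hsupp (xcoeff Phi k)"
    and b_supp: "b \<in> hsupp (reduce le_order (monomial lifted.F k))"
    by (rule set_plus_elim)
  obtain g where a_eq: "a = (g, 0)" "Phi (g, k) \<noteq> 0"
    using a_supp by (cases a) (auto simp: hsupp_def xcoeff_def split: if_splits)
  have "component (monomial lifted.F k) le_order b \<noteq> 0"
    using b_supp hsupp_reduce by (auto simp: hsupp_def)
  then have "b - (\<Sum>i\<in>UNIV. zmul (k $ i) (lead i)) \<in> tail_monoid"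
    using lifted.supported_from_monomial[of le_order k] unfolding lifted.supported_from_def by blast
  then have "c - fendo le F (g, k) \<in> tail_monoid" by (simp add: c_eq a_eq(1) fendo_eq_sum)
  with a_eq(2) show ?thesis by (rule that)
qed

context
  fixes Phi :: "'g \<times> (int^'n) \<Rightarrow> 'k"
  assumes Phi: "Phi \<in> hahn (fle le F)"
begin

lemma almost_full_on_fendo_image: "almost_full_on (\<preceq>) (fendo le F ` hsupp Phi)"
  unfolding wo_on_iff_almost_full_on[symmetric] wo_on_def
proof (intro allI impI)
  fix T assume T: "T \<subseteq> fendo le F ` hsupp Phi" "T \<noteq> {}"
  let ?S = "hsupp Phi \<inter> fendo le F -` T"
  have "?S \<noteq> {}" using T by blast
  moreover have "wo_on (fle le F) (hsupp Phi)" using Phi by (simp add: hahn_def)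
  ultimately obtain m where m_least: "m \<in> ?S" "\<forall>y\<in>?S. fle le F m y"
    unfolding wo_on_def by (meson Int_lower1)
  then have "\<forall>t\<in>T. fendo le F m \<preceq> t" using T(1) by (force simp: fle_def)
  then show "\<exists>m\<in>T. \<forall>t\<in>T. m \<preceq> t" using m_least(1) by blast
qed

lemma almost_full_on_xcoeff: "almost_full_on (\<preceq>) (hsupp (xcoeff Phi k))"
proof (rule almost_full_on_subset)
  show "almost_full_on (\<preceq>) (fendo le F ` hsupp Phi + {- fendo le F (0, k)})"
    by (intro almost_full_on_set_plus almost_full_on_fendo_image almost_full_on_singleton)
  show "hsupp (xcoeff Phi k) \<subseteq> fendo le F ` hsupp Phi + {- fendo le F (0, k)}"
  proof
    fix c assume "c \<in> hsupp (xcoeff Phi k)"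
    then obtain g where c_eq: "c = (g, 0)" "(g, k) \<in> hsupp Phi"
      by (cases c) (auto simp: hsupp_def xcoeff_def split: if_splits)
    have "c = fendo le F (g, k) + - fendo le F (0, k)"
      unfolding fendo_split[of le F g k] c_eq(1) by simp
    then show "c \<in> fendo le F ` hsupp Phi + {- fendo le F (0, k)}"
      using c_eq(2) by (metis imageI set_plus_intro singletonI)
  qed
qed

lemma almost_full_on_subst_terms: "almost_full_on (\<preceq>) (\<Union>k. hsupp (subst_terms le Phi F k))"
proof (rule almost_full_on_subset)
  show "almost_full_on (\<preceq>) (fendo le F ` hsupp Phi + tail_monoid)"
    by (intro almost_full_on_set_plus almost_full_on_fendo_image almost_full_on_tail_monoid)
  show "(\<Union>k. hsupp (subst_terms le Phi F k)) \<subseteq> fendo le F ` hsupp Phi + tail_monoid"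
  proof
    fix c assume "c \<in> (\<Union>k. hsupp (subst_terms le Phi F k))"
    then obtain k where "subst_terms le Phi F k c \<noteq> 0" by (auto simp: hsupp_def)
    then obtain g where "Phi (g, k) \<noteq> 0" "c - fendo le F (g, k) \<in> tail_monoid"
      by (rule subst_terms_supp)
    then have "fendo le F (g, k) + (c - fendo le F (g, k)) \<in> fendo le F ` hsupp Phi + tail_monoid"
      by (intro set_plus_intro imageI) (simp_all add: hsupp_def)
    then show "c \<in> fendo le F ` hsupp Phi + tail_monoid" by simp
  qed
qed

lemma finite_subst_terms: "finite {k. subst_terms le Phi F k c \<noteq> 0}"
proof (rule finite_subset)
  let ?A = "{a \<in> fendo le F ` hsupp Phi. c - a \<in> tail_monoid}"
  show "finite (snd ` (fendo le F -` ?A))"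
    by (intro finite_imageI finite_vimageI inj_fendo finite_decompositions
        almost_full_on_fendo_image almost_full_on_tail_monoid)
  show "{k. subst_terms le Phi F k c \<noteq> 0} \<subseteq> snd ` (fendo le F -` ?A)"
  proof
    fix k assume "k \<in> {k. subst_terms le Phi F k c \<noteq> 0}"
    then obtain g where "Phi (g, k) \<noteq> 0" "c - fendo le F (g, k) \<in> tail_monoid"
      using subst_terms_supp by blast
    then have "(g, k) \<in> fendo le F -` ?A" by (auto simp: hsupp_def)
    then show "k \<in> snd ` (fendo le F -` ?A)" by force
  qed
qed

theorem hsummable_subst_terms: "hsummable le (subst_terms le Phi F) UNIV"
proof -
  have "subst_terms le Phi F k \<in> hahn le" for k
    unfolding hahn_iff by (rule almost_full_on_subset[OF almost_full_on_subst_terms]) blast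
  then show ?thesis
    using almost_full_on_subst_terms finite_subst_terms
    by (simp add: hsummable_def wo_on_iff_almost_full_on)
qed

lemma hmul_subst:
  assumes "\<And>k g. reduce le_order (monomial lifted.F k * \<eta>) (g, h) =
    (if k = k0 \<and> g = 0 then v else 0)"
  shows "hmul (subst le Phi F) (reduce le_order \<eta>) (g, h) = v * Phi (g, k0)"
proof -
  have coeff: "hmul (subst_terms le Phi F k) (reduce le_order \<eta>) (g, h) =
      (if k = k0 then v * Phi (g, k0) else 0)" for k
  proof -
    have "hmul (subst_terms le Phi F k) (reduce le_order \<eta>) =
        hmul (xcoeff Phi k) (reduce le_order (monomial lifted.F k * \<eta>))"
      unfolding subst_terms_eq reduce_mult
      by (rule hmul_assoc) (simp_all add: almost_full_on_xcoeff)
    moreover have "hmul (xcoeff Phi k) (reduce le_order (monomial lifted.F k * \<eta>)) (g, h) =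
        (\<Sum>a\<in>{(g, 0)}. xcoeff Phi k a * reduce le_order (monomial lifted.F k * \<eta>) ((g, h) - a))"
      by (rule hmul_eq_sum) (auto simp: xcoeff_def assms split: if_splits)
    ultimately show ?thesis by (simp add: xcoeff_def assms)
  qed
  have "hmul (subst le Phi F) (reduce le_order \<eta>) =
      hsum (\<lambda>k. hmul (subst_terms le Phi F k) (reduce le_order \<eta>)) UNIV"
    unfolding subst_def
    by (rule hmul_hsum) (simp_all add: almost_full_on_subst_terms finite_subst_terms)
  then have "hmul (subst le Phi F) (reduce le_order \<eta>) (g, h) =
      hsum (\<lambda>k. hmul (subst_terms le Phi F k) (reduce le_order \<eta>)) UNIV (g, h)"
    by simp
  also have "\<dots> = (\<Sum>k\<in>{k0}. hmul (subst_terms le Phi F k) (reduce le_order \<eta>) (g, h))"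
    by (rule hsum_eq_sum) (auto simp: coeff)
  finally show ?thesis by (simp add: coeff)
qed

theorem CT_subst_logjacobian:
  "CTx (hmul (subst le Phi F) (logjacobian le F)) = (\<lambda>g. of_int (jacnum le F) * Phi (g, 0))"
  unfolding CTx_def logjacobian_eq
  by (intro ext hmul_subst) (simp add: reduce_def lifted.CT_monomial_log_jacobian jacnum_eq)

theorem Res_subst_jacobian:
  "Resx (hmul (subst le Phi F) (jacobian F)) = (\<lambda>g. of_int (jacnum le F) * Phi (g, - 1))"
  unfolding Resx_def jacobian_eq
  by (intro ext hmul_subst) (simp add: reduce_def lifted.Res_monomial_jacobian jacnum_eq)

end

end

theorem mainTheorem6:
  fixes le :: "'g::ab_group_add \<times> (int^'n::finite) \<Rightarrow> 'g \<times> (int^'n) \<Rightarrow> bool"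
    and F :: "'n \<Rightarrow> 'g \<times> (int^'n) \<Rightarrow> 'k::field"
    and Phi :: "'g \<times> (int^'n) \<Rightarrow> 'k"
  assumes "toa le"
    and "\<And>i. F i \<in> hahn le"
    and "\<And>i. F i \<noteq> (\<lambda>_. 0)"
    and "jacnum le F \<noteq> 0"
    and "Phi \<in> hahn (fle le F)"
  shows "hsummable le (subst_terms le Phi F) UNIV
    \<and> Resx (hmul (subst le Phi F) (jacobian F)) = (\<lambda>g. of_int (jacnum le F) * Phi (g, - 1))
    \<and> CTx (hmul (subst le Phi F) (logjacobian le F)) = (\<lambda>g. of_int (jacnum le F) * Phi (g, 0))"
proof -
  interpret residue_setting le F
    by unfold_locales (use assms in auto)
  show ?thesis
    using hsummable_subst_terms[OF assms(5)] Res_subst_jacobian[OF assms(5)]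
      CT_subst_logjacobian[OF assms(5)]
    by blast
qed

end
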